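(* Let $n\ge 1$ and let $\mathcal{P}_n$ be the poset of lattice path matroids on $[n]$ ordered by the quotient order $\le_q$. Then the good pair labeling $\lambda$ of the Hasse diagram of $\mathcal{P}_n$ is an EL-labeling of $\mathcal{P}_n$. That is, for every $x\le_q y$ in $\mathcal{P}_n$: (i) the interval $[x,y]$ contains a unique maximal chain whose label sequence is weakly increasing with respect to the componentwise order on $[n]\times[n]$; and (ii) this chain $C$ satisfies $C<_L C'$ for every other maximal chain $C'$ of $[x,y]$, where $<_L$ is the lexicographic order on label sequences.
   Context: Identify a monotone lattice path from $(0,0)$ to $(n-k,k)$ with unit East and North steps with the $k$-subset of $[n]$ recording the positions of its North steps. For $k$-subsets $U=\{u_1<\dots<u_k\}$ and $L=\{\ell_1<\dots<\ell_k\}$ of $[n]$ with $u_i\le \ell_i$ for all $i$ (the path $U$ never goes below $L$), the lattice path matroid (LPM) $M[U,L]$ is the matroid on $[n]$ whose bases are the $k$-sets $\{b_1<\dots<b_k\}$ with $u_i\le b_i\le \ell_i$ for all $i$ (the lattice paths between $U$ and $L$); it has rank $k$, and different pairs $(U,L)$ give different matroids. A matroid $M'$ is a quotient of a matroid $M$ on the same ground set $E$ if there is a matroid $N$ on $E\sqcup T$ with $M=N\setminus T$ and $M'=N/T$. $\mathcal{P}_n$ is the set of all LPMs on $[n]$ (of all ranks $0,\dots,n$) with $M'\le_q M$ iff $M'$ is a quotient of $M$. Known characterization (used as the working description): a pair $(\ell_i,u_j)$ with $\ell_i\in L$, $u_j\in U$ is a good pair of $M[U,L]$ if $i\le j$ and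 $u_j-\ell_i\le j-i$; a sequence of pairs $((\ell^{(1)},u^{(1)}),\dots,(\ell^{(z)},u^{(z)}))$ is a good pairing of $M[U,L]$ if for each $r$, $(\ell^{(r)},u^{(r)})$ is a good pair of $M[U\setminus\{u^{(1)},\dots,u^{(r-1)}\},L\setminus\{\ell^{(1)},\dots,\ell^{(r-1)}\}]$ (indices taken relative to these sets). If $U'\subseteq U$, $L'\subseteq L$ with $U\setminus U'=\{a_1<\dots<a_z\}$, $L\setminus L'=\{b_1<\dots<b_z\}$, the greedy pairing is $((b_1,a_1),\dots,(b_z,a_z))$. Then $M[U',L']\le_q M[U,L]$ iff $U'\subseteq U$, $L'\subseteq L$ and the greedy pairing is good. In particular covers in $\mathcal{P}_n$ have the form $M[U\setminus\{u\},L\setminus\{\ell\}]\lessdot M[U,L]$. The good pair labeling assigns to this cover the label $(\ell,u)\in[n]\times[n]$, and $[n]\times[n]$ is ordered componentwise: $(\ell,u)\le(\ell',u')$ iff $\ell\le \ell'$ and $u\le u'$. The label sequence of a saturated chain $x_0\lessdot x_1\lessdot\cdots\lessdot x_k$ is $(\lambda(x_0\lessdot x_1),\dots,\lambda(x_{k-1}\lessdot x_k))$; it is weakly increasing if its $i$-th entry is $\le$ its $j$-th entry whenever $i\le j$; $C<_L C'$ if there is $j$ with the first $j-1$ labels equal and $\lambda(C)_j<\lambda(C')_j$. *)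

theory Defs
  imports Main "HOL-Library.Product_Order"
begin

section \<open>Matroids and quotients\<close>

datatype 'a bases_system = Bases_System (ground: "'a set") (bases: "'a set set")

definition matroid :: "'a bases_system \<Rightarrow> bool" where
  "matroid M \<longleftrightarrow>
     finite (ground M) \<and> bases M \<noteq> {} \<and> (\<forall>B\<in>bases M. B \<subseteq> ground M) \<and>
     (\<forall>A\<in>bases M. \<forall>B\<in>bases M. \<forall>x\<in>A - B. \<exists>y\<in>B - A. insert y (A - {x}) \<in> bases M)"

definition indep :: "'a bases_system \<Rightarrow> 'a set \<Rightarrow> bool" where
  "indep M I \<longleftrightarrow> (\<exists>B\<in>bases M. I \<subseteq> B)"

definition deletion :: "'a bases_system \<Rightarrow> 'a set \<Rightarrow> 'a bases_system" where
  "deletion M T =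
     Bases_System (ground M - T)
       {B. B \<subseteq> ground M - T \<and> indep M B \<and>
           (\<forall>I. I \<subseteq> ground M - T \<and> indep M I \<and> B \<subseteq> I \<longrightarrow> I = B)}"

definition dual :: "'a bases_system \<Rightarrow> 'a bases_system" where
  "dual M = Bases_System (ground M) ((\<lambda>B. ground M - B) ` bases M)"

definition contraction :: "'a bases_system \<Rightarrow> 'a set \<Rightarrow> 'a bases_system" where
  "contraction M T = dual (deletion (dual M) T)"

text \<open>\<open>matroid_quotient M' M\<close>: \<open>M'\<close> is a quotient of \<open>M\<close>. The equations force
  \<open>ground M = ground M' = ground N - T\<close>, and \<open>T\<close> is finite because \<open>N\<close> is a matroid. The
  elements of \<open>T\<close> are taken from the type of the ground set, which loses no generality when
  that type is infinite; below it is \<open>nat\<close>.\<close>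

definition matroid_quotient :: "'a bases_system \<Rightarrow> 'a bases_system \<Rightarrow> bool" where
  "matroid_quotient M' M \<longleftrightarrow>
     (\<exists>N T. matroid N \<and> T \<subseteq> ground N \<and> M = deletion N T \<and> M' = contraction N T)"

section \<open>Lattice path matroids\<close>

text \<open>For finite sets, \<open>path_le A B\<close> says that \<open>A\<close> and \<open>B\<close> have the same cardinality and
  that the \<open>i\<close>-th smallest element of \<open>A\<close> is at most that of \<open>B\<close>, for all \<open>i\<close>.\<close>

definition path_le :: "nat set \<Rightarrow> nat set \<Rightarrow> bool" where
  "path_le A B \<longleftrightarrow> list_all2 (\<le>) (sorted_list_of_set A) (sorted_list_of_set B)"

definition lpm_pair :: "nat \<Rightarrow> nat set \<Rightarrow> nat set \<Rightarrow> bool" where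
  "lpm_pair n U L \<longleftrightarrow> U \<subseteq> {1..n} \<and> L \<subseteq> {1..n} \<and> path_le U L"

definition lpm :: "nat \<Rightarrow> nat set \<Rightarrow> nat set \<Rightarrow> nat bases_system" where
  "lpm n U L = Bases_System {1..n} {B. B \<subseteq> {1..n} \<and> path_le U B \<and> path_le B L}"

definition LPMs :: "nat \<Rightarrow> nat bases_system set" where
  "LPMs n = {lpm n U L | U L. lpm_pair n U L}"

text \<open>The label of \<open>M[U - {u}, L - {l}] \<lessdot> M[U, L]\<close> is \<open>(l, u)\<close>: the element of the lower
  path comes first. The description is proper because an LPM determines its pair \<open>(U, L)\<close>.\<close>

definition good_pair_label :: "nat \<Rightarrow> nat bases_system \<Rightarrow> nat bases_system \<Rightarrow> nat \<times> nat" where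
  "good_pair_label n M' M =
     (THE (l, u). \<exists>U L. lpm_pair n U L \<and> l \<in> L \<and> u \<in> U \<and> lpm_pair n (U - {u}) (L - {l}) \<and>
        M = lpm n U L \<and> M' = lpm n (U - {u}) (L - {l}))"

section \<open>EL-labelings\<close>

definition strict :: "('a \<Rightarrow> 'a \<Rightarrow> bool) \<Rightarrow> 'a \<Rightarrow> 'a \<Rightarrow> bool" where
  "strict le x y \<longleftrightarrow> le x y \<and> x \<noteq> y"

definition covers :: "'a set \<Rightarrow> ('a \<Rightarrow> 'a \<Rightarrow> bool) \<Rightarrow> 'a \<Rightarrow> 'a \<Rightarrow> bool" where
  "covers P le x y \<longleftrightarrow>
     x \<in> P \<and> y \<in> P \<and> strict le x y \<and> \<not> (\<exists>z\<in>P. strict le x z \<and> strict le z y)"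

definition interval :: "'a set \<Rightarrow> ('a \<Rightarrow> 'a \<Rightarrow> bool) \<Rightarrow> 'a \<Rightarrow> 'a \<Rightarrow> 'a set" where
  "interval P le x y = {z \<in> P. le x z \<and> le z y}"

text \<open>A finite maximal chain of \<open>[x, y]\<close>, as the list of its elements from bottom to top;
  consecutive elements are then in the cover relation.\<close>

definition maximal_chain ::
  "'a set \<Rightarrow> ('a \<Rightarrow> 'a \<Rightarrow> bool) \<Rightarrow> 'a \<Rightarrow> 'a \<Rightarrow> 'a list \<Rightarrow> bool" where
  "maximal_chain P le x y C \<longleftrightarrow>
     sorted_wrt (strict le) C \<and> pred_on.maxchain (interval P le x y) (strict le) (set C)"

definition label_seq :: "('a \<Rightarrow> 'a \<Rightarrow> 'b) \<Rightarrow> 'a list \<Rightarrow> 'b list" where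
  "label_seq lab C = map2 lab C (tl C)"

definition lex_less :: "'b::order list \<Rightarrow> 'b list \<Rightarrow> bool" where
  "lex_less s t \<longleftrightarrow>
     (\<exists>j. j < length s \<and> j < length t \<and> take j s = take j t \<and> s ! j < t ! j)"

definition EL_labeling ::
  "'a set \<Rightarrow> ('a \<Rightarrow> 'a \<Rightarrow> bool) \<Rightarrow> 'b::order set \<Rightarrow> ('a \<Rightarrow> 'a \<Rightarrow> 'b) \<Rightarrow> bool" where
  "EL_labeling P le Lab lab \<longleftrightarrow>
     (\<forall>x y. covers P le x y \<longrightarrow> lab x y \<in> Lab) \<and>
     (\<forall>x\<in>P. \<forall>y\<in>P. le x y \<longrightarrow>
        (\<exists>C. maximal_chain P le x y C \<and> sorted_wrt (\<le>) (label_seq lab C) \<and>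
             (\<forall>C'. maximal_chain P le x y C' \<and> sorted_wrt (\<le>) (label_seq lab C') \<longrightarrow> C' = C) \<and>
             (\<forall>C'. maximal_chain P le x y C' \<and> C' \<noteq> C \<longrightarrow>
                   lex_less (label_seq lab C) (label_seq lab C'))))"

end

theory Submission
  imports Defs
begin

text \<open>\<open>M'\<close> is a quotient of \<open>M\<close> iff \<open>rk M - rk M'\<close> is monotone under inclusion (the converse by
  the Higgs lift). For lattice path matroids this is tested on unions of two intervals, and it
  holds iff the pairs removed from \<open>(U, L)\<close>, matched in increasing order, are all good; sufficiency
  comes from a symmetric exchange of bases when a single pair is removed. Goodness of a matched pair
  depends only on its position in \<open>(U, L)\<close> among smaller elements, so removing the largest removable
  elements of \<open>U\<close> and \<open>L\<close> keeps the remaining pairs good. Read from the bottom, the chain so obtained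
  has the labels \<open>(b\<^sub>1, a\<^sub>1), \<dots>, (b\<^sub>z, a\<^sub>z)\<close>, with \<open>L - L' = {b\<^sub>1 < \<dots> < b\<^sub>z}\<close> and
  \<open>U - U' = {a\<^sub>1 < \<dots> < a\<^sub>z}\<close>. The labels of every other maximal chain list the same two sets in a
  different way, so at the first difference they are larger in the product order.\<close>

section \<open>Rank functions and matroid quotients\<close>

text \<open>The definition of a quotient quantifies over an unknown larger matroid. The rank
  inequality eliminates it, and since such inequalities add up, quotients compose and sufficiency
  reduces to the removal of one pair. Paths are handled through their heights
  \<open>cnt S t\<close>: a base is a height function squeezed between two others, and swapping two
  elements shifts it by one on an interval, so the exchange becomes a discrete crossing argument.
  Goodness of \<open>(b, a)\<close> is geometric: the North step \<open>a\<close> of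
  \<open>U\<close> ends at height \<open>cnt U a\<close> after \<open>a - cnt U a\<close> East
  steps, so the two inequalities of \<open>good_pair\<close> place it weakly above and weakly left
  of the North step \<open>b\<close> of \<open>L\<close>. Each inequality enters twice: its failure
  yields a test set that violates the rank inequality, and its validity rules out one of the two
  ways in which both exchanges could be blocked. The greedy pairing removes the smallest pair first,
  which shifts the indices of all later pairs; removal from the large end shifts none.\<close>

definition rk :: "'a bases_system \<Rightarrow> 'a set \<Rightarrow> nat" where
  "rk M X = Max ((\<lambda>B. card (B \<inter> X)) ` bases M)"

text \<open>Enough structure for the elementary theory of \<open>rk\<close>. Deletions and
  contractions are only shown to have this property, which avoids proving their exchange
  axioms.\<close>

definition equicardinal :: "'a bases_system \<Rightarrow> bool" where
  "equicardinal M \<longleftrightarrow> finite (ground M) \<and> bases M \<noteq> {} \<and> (\<forall>B\<in>bases M. B \<subseteq> ground M) \<and>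
     (\<forall>A\<in>bases M. \<forall>B\<in>bases M. card A = card B)"

text \<open>The one-element form of monotonicity of \<open>rk M - rk M'\<close>, written additively
  because subtraction on \<open>nat\<close> truncates.\<close>

definition rank_quotient :: "'a bases_system \<Rightarrow> 'a bases_system \<Rightarrow> bool" where
  "rank_quotient M' M \<longleftrightarrow> ground M' = ground M \<and>
     (\<forall>X. \<forall>y\<in>ground M. X \<subseteq> ground M \<longrightarrow>
        rk M' (insert y X) + rk M X \<le> rk M (insert y X) + rk M' X)"

lemma indepI: "B \<in> bases M \<Longrightarrow> I \<subseteq> B \<Longrightarrow> indep M I"
  unfolding indep_def by blast

text \<open>An exchange keeps the size of \<open>A\<close> and brings it closer to \<open>B\<close>.
  Once \<open>A\<close> is contained in \<open>B\<close>, an element of \<open>B - A\<close> would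
  need a partner in the empty set \<open>A - B\<close>.\<close>

lemma matroid_card_le:
  assumes "matroid M" "A \<in> bases M" "B \<in> bases M"
  shows "card A = card B"
  using assms(2)
proof (induction "card (A - B)" arbitrary: A rule: less_induct)
  case less
  have fin: "finite A" "finite B"
    using assms less.prems by (meson matroid_def finite_subset)+
  show ?case
  proof (cases "A \<subseteq> B")
    case True
    have "B - A = {}"
      using assms(1,3) less.prems True unfolding matroid_def by blast
    then show ?thesis using True by auto
  next
    case False
    then obtain x where x: "x \<in> A - B" by auto
    then obtain y where y: "y \<in> B - A" "insert y (A - {x}) \<in> bases M"
      using assms(1,3) less.prems unfolding matroid_def by blast
    have "insert y (A - {x}) - B \<subset> A - B" using x y by auto
    then have "card (insert y (A - {x}) - B) < card (A - B)"
      by (intro psubset_card_mono) (use fin in auto)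
    then have "card (insert y (A - {x})) = card B" using less.hyps y by blast
    moreover have "card (insert y (A - {x})) = card A"
      using x y fin by (metis Diff_iff card.remove card_insert_disjoint finite_Diff)
    ultimately show ?thesis by simp
  qed
qed

lemma matroid_equicardinal: "matroid M \<Longrightarrow> equicardinal M"
  unfolding equicardinal_def
  by (intro conjI ballI; (rule matroid_card_le)?; (simp add: matroid_def; fail)?)

context
  fixes M :: "'a bases_system"
  assumes eq: "equicardinal M"
begin

lemma finite_ground: "finite (ground M)"
  using eq by (simp add: equicardinal_def)

lemma base_subset_ground: "B \<in> bases M \<Longrightarrow> B \<subseteq> ground M"
  using eq by (simp add: equicardinal_def)

lemma finite_base: "B \<in> bases M \<Longrightarrow> finite B"
  using base_subset_ground finite_ground finite_subset by blast

lemma finite_bases: "finite (bases M)"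
  using base_subset_ground finite_ground by (meson Pow_iff finite_Pow_iff finite_subset subsetI)

lemma card_base_Int_le_rk: "B \<in> bases M \<Longrightarrow> card (B \<inter> X) \<le> rk M X"
  unfolding rk_def using finite_bases by (intro Max_ge) auto

lemma rk_attained: obtains B where "B \<in> bases M" "card (B \<inter> X) = rk M X"
proof -
  have "rk M X \<in> (\<lambda>B. card (B \<inter> X)) ` bases M"
    unfolding rk_def using finite_bases eq by (intro Max_in) (auto simp: equicardinal_def)
  then show ?thesis using that by auto
qed

lemma rk_leI: "(\<And>B. B \<in> bases M \<Longrightarrow> card (B \<inter> X) \<le> c) \<Longrightarrow> rk M X \<le> c"
  by (metis rk_attained)

lemma card_base: assumes "B \<in> bases M" shows "card B = rk M (ground M)"
proof -
  obtain C where "C \<in> bases M" "card (C \<inter> ground M) = rk M (ground M)" by (rule rk_attained)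
  moreover have "C \<inter> ground M = C" using base_subset_ground calculation by blast
  ultimately show ?thesis using assms eq unfolding equicardinal_def by metis
qed

lemma indep_subset_ground: "indep M I \<Longrightarrow> I \<subseteq> ground M"
  using base_subset_ground unfolding indep_def by blast

lemma finite_indep: "indep M I \<Longrightarrow> finite I"
  using indep_subset_ground finite_ground finite_subset by blast

lemma indep_mono: "indep M J \<Longrightarrow> I \<subseteq> J \<Longrightarrow> indep M I"
  unfolding indep_def by blast

lemma card_indep_le_rk: assumes "indep M I" "I \<subseteq> X" shows "card I \<le> rk M X"
proof -
  obtain B where B: "B \<in> bases M" "I \<subseteq> B" using assms unfolding indep_def by blast
  then have "card I \<le> card (B \<inter> X)"
    by (intro card_mono) (use assms finite_base in auto)
  then show ?thesis using card_base_Int_le_rk[OF B(1)] le_trans by blast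
qed

lemma rk_mono: assumes "X \<subseteq> Y" shows "rk M X \<le> rk M Y"
proof (rule rk_leI)
  fix B assume B: "B \<in> bases M"
  have "card (B \<inter> X) \<le> card (B \<inter> Y)"
    by (intro card_mono) (use assms finite_base B in auto)
  then show "card (B \<inter> X) \<le> rk M Y" using card_base_Int_le_rk[OF B] le_trans by blast
qed

lemma rk_insert_le: "rk M (insert y X) \<le> Suc (rk M X)"
proof (rule rk_leI)
  fix B assume B: "B \<in> bases M"
  have "card (B \<inter> insert y X) \<le> card (insert y (B \<inter> X))"
    by (intro card_mono) (use finite_base B in auto)
  also have "\<dots> \<le> Suc (card (B \<inter> X))" by (simp add: card_insert_if finite_base B)
  finally show "card (B \<inter> insert y X) \<le> Suc (rk M X)"
    using card_base_Int_le_rk[OF B, of X] by linarith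
qed

lemma rk_Un_le: "rk M (X \<union> Y) \<le> rk M X + rk M Y"
proof (rule rk_leI)
  fix B assume B: "B \<in> bases M"
  have "card (B \<inter> (X \<union> Y)) \<le> card (B \<inter> X) + card (B \<inter> Y)"
    by (metis Int_Un_distrib card_Un_le)
  then show "card (B \<inter> (X \<union> Y)) \<le> rk M X + rk M Y"
    using card_base_Int_le_rk[OF B] by (meson add_mono order_trans)
qed

lemma rk_le_card: assumes "finite X" shows "rk M X \<le> card X"
  by (rule rk_leI) (simp add: assms card_mono)

lemma indep_iff_rk:
  assumes "X \<subseteq> ground M" shows "indep M X \<longleftrightarrow> rk M X = card X"
proof
  have fin: "finite X" using assms finite_ground finite_subset by blast
  show "indep M X \<Longrightarrow> rk M X = card X"
    by (simp add: card_indep_le_rk rk_le_card fin le_antisym)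
  assume "rk M X = card X"
  then obtain B where "B \<in> bases M" "card (B \<inter> X) = card X" by (metis rk_attained)
  then show "indep M X" unfolding indep_def
    by (metis Int_lower2 card_subset_eq fin inf.orderI inf.commute)
qed

lemma base_iff_indep: "B \<in> bases M \<longleftrightarrow> indep M B \<and> card B = rk M (ground M)"
proof
  show "B \<in> bases M \<Longrightarrow> indep M B \<and> card B = rk M (ground M)"
    using card_base unfolding indep_def by auto
  assume *: "indep M B \<and> card B = rk M (ground M)"
  then obtain C where C: "C \<in> bases M" "B \<subseteq> C" unfolding indep_def by blast
  then have "B = C" using * card_base[OF C(1)] finite_base[OF C(1)] by (simp add: card_subset_eq)
  then show "B \<in> bases M" using C by simp
qed

lemma equicardinal_dual: "equicardinal (dual M)"
proof -
  have "card (ground M - B) = card (ground M) - rk M (ground M)" if "B \<in> bases M" for B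
    using that by (simp add: card_Diff_subset finite_base base_subset_ground card_base)
  then show ?thesis
    using eq finite_ground unfolding equicardinal_def dual_def by auto
qed

end

lemma dual_simps [simp]: "ground (dual M) = ground M"
  "bases (dual M) = (\<lambda>B. ground M - B) ` bases M"
  by (simp_all add: dual_def)

text \<open>For each base \<open>B\<close>, the trace of its complement on \<open>X\<close> and the
  trace of \<open>B\<close> on the complement of \<open>X\<close> differ by a constant, so both are
  maximal for the same \<open>B\<close>.\<close>

lemma rk_dual:
  assumes eq: "equicardinal M" and X: "X \<subseteq> ground M"
  shows "rk (dual M) X + rk M (ground M) = card X + rk M (ground M - X)"
proof -
  have *: "card ((ground M - B) \<inter> X) + rk M (ground M) = card X + card (B \<inter> (ground M - X))"
    if B: "B \<in> bases M" for B
  proof -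
    have fin: "finite X" "finite B" using X finite_ground[OF eq] finite_subset finite_base[OF eq B]
      by auto
    have "(ground M - B) \<inter> X = X - B" using X by blast
    moreover have "card X = card (X - B) + card (B \<inter> X)"
      by (metis fin(1) card_Diff_subset_Int Int_commute card_mono finite_Int inf_le1
          le_add_diff_inverse2)
    moreover have "card B = card (B \<inter> X) + card (B \<inter> (ground M - X))"
      using base_subset_ground[OF eq B] fin
      by (subst card_Un_disjoint[symmetric]) (auto intro!: arg_cong[of _ _ card])
    ultimately show ?thesis using card_base[OF eq B] by simp
  qed
  note eqd = equicardinal_dual[OF eq]
  show ?thesis
  proof (rule antisym)
    obtain C where "C \<in> bases (dual M)" "card (C \<inter> X) = rk (dual M) X" by (rule rk_attained[OF eqd])
    then obtain B where B: "B \<in> bases M" "card ((ground M - B) \<inter> X) = rk (dual M) X" by auto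
    show "rk (dual M) X + rk M (ground M) \<le> card X + rk M (ground M - X)"
      using *[OF B(1)] card_base_Int_le_rk[OF eq B(1), of "ground M - X"] B(2) by linarith
  next
    obtain B where B: "B \<in> bases M" "card (B \<inter> (ground M - X)) = rk M (ground M - X)"
      by (rule rk_attained[OF eq])
    then have "ground M - B \<in> bases (dual M)" by simp
    then show "card X + rk M (ground M - X) \<le> rk (dual M) X + rk M (ground M)"
      using *[OF B(1)] card_base_Int_le_rk[OF eqd, of "ground M - B" X] B(2) by linarith
  qed
qed

text \<open>Extend \<open>I\<close> and \<open>J\<close> to bases \<open>A\<close> and
  \<open>B\<close>, with \<open>B\<close> having as few elements as possible outside
  \<open>J\<close> and \<open>A\<close>. Exchanging such an element for one of \<open>A\<close>
  would improve \<open>B\<close>, so there is none. If no augmentation exists, \<open>B - A\<close>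
  equals \<open>J - I\<close> while \<open>A - B\<close> lies in \<open>I - J\<close>, and the sizes
  clash.\<close>

lemma indep_augment:
  assumes M: "matroid M" and I: "indep M I" and J: "indep M J" and lt: "card I < card J"
  shows "\<exists>y\<in>J - I. indep M (insert y I)"
proof (rule ccontr)
  assume no: "\<not> ?thesis"
  note eq = matroid_equicardinal[OF M]
  note fb = finite_base[OF eq]
  have exch: "\<exists>y\<in>B - A. insert y (A - {x}) \<in> bases M"
    if "A \<in> bases M" "B \<in> bases M" "x \<in> A - B" for A B x
    using M that unfolding matroid_def by blast
  obtain A where A: "A \<in> bases M" "I \<subseteq> A" using I indep_def by metis
  obtain B0 where "B0 \<in> bases M \<and> J \<subseteq> B0" using J indep_def by metis
  then obtain B where B: "B \<in> bases M" "J \<subseteq> B"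
    and least: "\<And>C. C \<in> bases M \<Longrightarrow> J \<subseteq> C \<Longrightarrow> card (B - (J \<union> A)) \<le> card (C - (J \<union> A))"
    using ex_has_least_nat[of "\<lambda>B. B \<in> bases M \<and> J \<subseteq> B" B0 "\<lambda>B. card (B - (J \<union> A))"] by blast
  \<comment> \<open>An element of \<open>J - I\<close> inside the base \<open>A\<close> would
    already augment \<open>I\<close>.\<close>
  have AJ: "A \<inter> J \<subseteq> I"
    using no A unfolding indep_def by blast
  have "B - (J \<union> A) = {}"
  proof (rule ccontr)
    assume "B - (J \<union> A) \<noteq> {}"
    then obtain x where x: "x \<in> B - (J \<union> A)" by blast
    then obtain y where y: "y \<in> A - B" "insert y (B - {x}) \<in> bases M"
      using exch[OF B(1) A(1), of x] by blast
    have "insert y (B - {x}) - (J \<union> A) \<subset> B - (J \<union> A)" using x y by auto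
    then have "card (insert y (B - {x}) - (J \<union> A)) < card (B - (J \<union> A))"
      by (intro psubset_card_mono) (use fb[OF B(1)] in auto)
    moreover have "J \<subseteq> insert y (B - {x})" using B x by blast
    ultimately show False using least y(2) by fastforce
  qed
  then have BA: "B - A = J - I" using AJ A B by blast
  have AI: "A - B \<subseteq> I - J"
  proof
    fix x assume x: "x \<in> A - B"
    show "x \<in> I - J"
    proof (rule ccontr)
      assume "x \<notin> I - J"
      then have "x \<notin> I" using x B by blast
      obtain y where y: "y \<in> B - A" "insert y (A - {x}) \<in> bases M"
        using exch[OF A(1) B(1) x] by blast
      have "insert y I \<subseteq> insert y (A - {x})" using \<open>x \<notin> I\<close> A(2) by blast
      then have "indep M (insert y I)" by (rule indepI[OF y(2)])
      moreover have "y \<in> J - I" using y(1) BA by simp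
      ultimately show False using no by blast
    qed
  qed
  have finI: "finite I" "finite J" using finite_indep[OF eq] I J by auto
  have "card (A - B) = card (B - A)"
    using matroid_card_le[OF M A(1) B(1)] fb A B
    by (simp add: card_Diff_subset_Int Int_commute)
  moreover have "card (A - B) \<le> card (I - J)" using AI finI by (intro card_mono) auto
  ultimately show False using card_less_sym_Diff[OF finI lt] BA by simp
qed

context
  fixes M :: "'a bases_system"
  assumes mat: "matroid M"
begin

lemmas eqm = matroid_equicardinal[OF mat]

lemma indep_extend:
  assumes "indep M I" "I \<subseteq> X"
  obtains J where "indep M J" "I \<subseteq> J" "J \<subseteq> X" "card J = rk M X"
proof -
  have "\<exists>J. indep M J \<and> I \<subseteq> J \<and> J \<subseteq> X \<and> card J = rk M X"
    using assms
  proof (induction "rk M X - card I" arbitrary: I rule: less_induct)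
    case less
    have le: "card I \<le> rk M X" using card_indep_le_rk[OF eqm] less.prems by blast
    show ?case
    proof (cases "card I = rk M X")
      case False
      obtain B where B: "B \<in> bases M" "card (B \<inter> X) = rk M X" by (rule rk_attained[OF eqm])
      then have "indep M (B \<inter> X)" by (intro indepI) auto
      moreover have "card I < card (B \<inter> X)" using False le B by simp
      ultimately obtain y where y: "y \<in> B \<inter> X - I" "indep M (insert y I)"
        using indep_augment[OF mat less.prems(1)] by blast
      have "card (insert y I) = Suc (card I)" using y finite_indep[OF eqm less.prems(1)] by simp
      then have "rk M X - card (insert y I) < rk M X - card I" using False le by simp
      then have "\<exists>J. indep M J \<and> insert y I \<subseteq> J \<and> J \<subseteq> X \<and> card J = rk M X"
        using less.hyps[of "insert y I"] y less.prems(2) by auto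
      then show ?thesis by blast
    qed (use less.prems in blast)
  qed
  then show ?thesis by (elim exE conjE) (rule that)
qed

lemma indep_empty: "indep M {}"
  using eqm unfolding indep_def equicardinal_def by blast

lemma obtain_basis: obtains J where "indep M J" "J \<subseteq> X" "card J = rk M X"
  by (rule indep_extend[OF indep_empty, of X]) auto

text \<open>This is closure: elements that do not raise the rank one by one do not raise it
  together. A basis of \<open>X\<close> that grew inside the union would grow by some single
  \<open>y\<close> first.\<close>

lemma rk_Un_eqI:
  assumes "\<And>y. y \<in> Y \<Longrightarrow> rk M (insert y X) = rk M X"
  shows "rk M (X \<union> Y) = rk M X"
proof -
  obtain I where I: "indep M I" "I \<subseteq> X" "card I = rk M X" by (rule obtain_basis)
  then obtain J where J: "indep M J" "I \<subseteq> J" "J \<subseteq> X \<union> Y" "card J = rk M (X \<union> Y)"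
    using indep_extend[OF I(1), of "X \<union> Y"] by blast
  have "J = I"
  proof (rule ccontr)
    assume "J \<noteq> I"
    then obtain y where y: "y \<in> J - I" using J by blast
    then have "indep M (insert y I)" using J indep_mono[OF eqm J(1)] by blast
    then have "card (insert y I) \<le> rk M (insert y X)" using card_indep_le_rk[OF eqm] I by blast
    moreover have "card (insert y I) = Suc (rk M X)" using I y finite_indep[OF eqm I(1)] by simp
    moreover have "rk M (insert y X) = rk M X"
      using assms y J by (metis Diff_iff Un_iff insert_absorb subsetD)
    ultimately show False by simp
  qed
  then show ?thesis using I J by simp
qed

text \<open>Extend a basis \<open>I\<close> of the intersection to a basis \<open>J\<close> of the
  union and count the traces of \<open>J\<close> on \<open>X\<close> and \<open>Y\<close>, which
  overlap at least in \<open>I\<close>.\<close>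

lemma rk_submodular: "rk M (X \<union> Y) + rk M (X \<inter> Y) \<le> rk M X + rk M Y"
proof -
  obtain I where I: "indep M I" "I \<subseteq> X \<inter> Y" "card I = rk M (X \<inter> Y)" by (rule obtain_basis)
  then obtain J where J: "indep M J" "I \<subseteq> J" "J \<subseteq> X \<union> Y" "card J = rk M (X \<union> Y)"
    using indep_extend[OF I(1), of "X \<union> Y"] by blast
  have fin: "finite J" using J finite_indep[OF eqm] by blast
  have "card (J \<inter> X) + card (J \<inter> Y) = card ((J \<inter> X) \<union> (J \<inter> Y)) + card ((J \<inter> X) \<inter> (J \<inter> Y))"
    using fin by (intro card_Un_Int) auto
  moreover have "(J \<inter> X) \<union> (J \<inter> Y) = J" using J by blast
  moreover have "card I \<le> card ((J \<inter> X) \<inter> (J \<inter> Y))" using I J fin by (intro card_mono) auto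
  moreover have "card (J \<inter> X) \<le> rk M X" "card (J \<inter> Y) \<le> rk M Y"
    using card_indep_le_rk[OF eqm] indep_mono[OF eqm J(1)] by auto
  ultimately show ?thesis using I J by simp
qed

text \<open>Complementation turns the exchange axiom into one where the incoming element
  \<open>x\<close> is prescribed and the outgoing element is to be found.\<close>

lemma matroid_dual: "matroid (dual M)"
proof -
  have "\<exists>y\<in>A - B. insert x (A - {y}) \<in> bases M"
    if A: "A \<in> bases M" and B: "B \<in> bases M" and x: "x \<in> B - A" for A B x
  proof -
    \<comment> \<open>Extending this set to a base inside \<open>insert x A\<close> keeps
      \<open>x\<close> and all of \<open>A\<close> that lies in \<open>B\<close>, so the one element
      of \<open>A\<close> that is lost lies outside \<open>B\<close>.\<close>
    have "indep M (insert x (A \<inter> B))" by (rule indepI[OF B]) (use x in blast)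
    then obtain J where J: "indep M J" "insert x (A \<inter> B) \<subseteq> J" "J \<subseteq> insert x A"
        "card J = rk M (insert x A)"
      using indep_extend[of "insert x (A \<inter> B)" "insert x A"] by blast
    have "rk M (insert x A) = rk M (ground M)"
    proof (rule antisym)
      show "rk M (insert x A) \<le> rk M (ground M)"
        by (intro rk_mono[OF eqm]) (use A B x base_subset_ground[OF eqm] in auto)
      show "rk M (ground M) \<le> rk M (insert x A)"
        using card_base_Int_le_rk[OF eqm A, of "insert x A"] card_base[OF eqm A]
        by (simp add: Int_absorb2 subset_insertI)
    qed
    then have JB: "J \<in> bases M" using J base_iff_indep[OF eqm] by simp
    have "card J = card A" using JB A matroid_card_le[OF mat] by blast
    moreover have fin: "finite A" "finite J" using A JB finite_base[OF eqm] by auto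
    moreover have "x \<in> J" "x \<notin> A" using J x by auto
    ultimately have "\<not> A \<subseteq> J" by (metis card_subset_eq)
    then obtain y where y: "y \<in> A" "y \<notin> J" by blast
    have "J \<subseteq> insert x (A - {y})" using J y by blast
    moreover have "card (insert x (A - {y})) = card A"
      using y fin \<open>x \<notin> A\<close> by (metis Diff_iff card.remove card_insert_disjoint finite_Diff)
    ultimately have "J = insert x (A - {y})"
      using \<open>card J = card A\<close> fin by (intro card_subset_eq) auto
    then show ?thesis using JB J y by blast
  qed
  note exch = this
  have "\<exists>y\<in>(ground M - B) - (ground M - A).
          insert y ((ground M - A) - {x}) \<in> (\<lambda>B. ground M - B) ` bases M"
    if A: "A \<in> bases M" and B: "B \<in> bases M" and x: "x \<in> (ground M - A) - (ground M - B)" for A B x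
  proof -
    have "x \<in> B - A" using x by blast
    then obtain y where y: "y \<in> A - B" "insert x (A - {y}) \<in> bases M"
      using exch[OF A B] by blast
    moreover have "insert y ((ground M - A) - {x}) = ground M - insert x (A - {y})"
      using y(1) x base_subset_ground[OF eqm A] by blast
    ultimately show ?thesis using base_subset_ground[OF eqm A] by blast
  qed
  then show ?thesis
    using mat unfolding matroid_def by (auto 0 3)
qed

end

section \<open>Deletion and contraction in terms of rank\<close>

lemma deletion_simps [simp]: "ground (deletion M T) = ground M - T"
  by (simp add: deletion_def)

text \<open>By augmentation, independent subsets of \<open>ground M - T\<close> that are maximal
  under inclusion are also maximal in size.\<close>

lemma bases_deletion:
  assumes "matroid M"
  shows "bases (deletion M T) =
    {B. B \<subseteq> ground M - T \<and> indep M B \<and> card B = rk M (ground M - T)}"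
proof -
  note eq = matroid_equicardinal[OF assms]
  have "(\<forall>I. I \<subseteq> ground M - T \<and> indep M I \<and> B \<subseteq> I \<longrightarrow> I = B) \<longleftrightarrow> card B = rk M (ground M - T)"
    if B: "B \<subseteq> ground M - T" "indep M B" for B
  proof
    assume max: "\<forall>I. I \<subseteq> ground M - T \<and> indep M I \<and> B \<subseteq> I \<longrightarrow> I = B"
    obtain J where "indep M J" "B \<subseteq> J" "J \<subseteq> ground M - T" "card J = rk M (ground M - T)"
      by (rule indep_extend[OF assms B(2,1)])
    then show "card B = rk M (ground M - T)" using max by blast
  next
    assume "card B = rk M (ground M - T)"
    then show "\<forall>I. I \<subseteq> ground M - T \<and> indep M I \<and> B \<subseteq> I \<longrightarrow> I = B"
      by (metis card_indep_le_rk[OF eq] card_seteq finite_indep[OF eq])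
  qed
  then show ?thesis unfolding deletion_def by auto
qed

lemma equicardinal_deletion: "matroid M \<Longrightarrow> equicardinal (deletion M T)"
proof -
  assume M: "matroid M"
  obtain J where "indep M J" "J \<subseteq> ground M - T" "card J = rk M (ground M - T)"
    by (rule obtain_basis[OF M])
  then have "bases (deletion M T) \<noteq> {}" using bases_deletion[OF M] by blast
  then show ?thesis
    using finite_ground[OF matroid_equicardinal[OF M]]
    by (auto simp: equicardinal_def bases_deletion[OF M])
qed

lemma rk_deletion:
  assumes M: "matroid M" and X: "X \<subseteq> ground M - T"
  shows "rk (deletion M T) X = rk M X"
proof (rule antisym)
  note eq = matroid_equicardinal[OF M]
  note eqd = equicardinal_deletion[OF M]
  show "rk (deletion M T) X \<le> rk M X"
  proof (rule rk_leI[OF eqd])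
    fix B assume "B \<in> bases (deletion M T)"
    then have "indep M B" by (simp add: bases_deletion[OF M])
    then show "card (B \<inter> X) \<le> rk M X"
      using card_indep_le_rk[OF eq indep_mono[OF eq, of B "B \<inter> X"], of X] by simp
  qed
  obtain I where I: "indep M I" "I \<subseteq> X" "card I = rk M X" by (rule obtain_basis[OF M])
  have "I \<subseteq> ground M - T" using I(2) X by simp
  then obtain J where J: "indep M J" "I \<subseteq> J" "J \<subseteq> ground M - T" "card J = rk M (ground M - T)"
    by (rule indep_extend[OF M I(1)])
  then have "J \<in> bases (deletion M T)" by (simp add: bases_deletion[OF M])
  then have "card (J \<inter> X) \<le> rk (deletion M T) X" by (rule card_base_Int_le_rk[OF eqd])
  moreover have "card I \<le> card (J \<inter> X)"
    using I J finite_indep[OF eq J(1)] by (intro card_mono) auto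
  ultimately show "rk M X \<le> rk (deletion M T) X" using I by simp
qed

text \<open>Contraction is the dual of a deletion of the dual, so the rank formula for duals is
  applied to the outer and to the inner dual; the sizes and the full rank cancel.\<close>

lemma rk_contraction:
  assumes M: "matroid M" and T: "T \<subseteq> ground M" and X: "X \<subseteq> ground M - T"
  shows "rk (contraction M T) X + rk M T = rk M (X \<union> T)"
proof -
  let ?E = "ground M - T"
  note eq = matroid_equicardinal[OF M]
  have "rk (contraction M T) X + rk (deletion (dual M) T) ?E
      = card X + rk (deletion (dual M) T) (?E - X)"
    using rk_dual[OF equicardinal_deletion[OF matroid_dual[OF M]], of X T] X
    unfolding contraction_def by simp
  then have "rk (contraction M T) X + rk (dual M) ?E = card X + rk (dual M) (?E - X)"
    using rk_deletion[OF matroid_dual[OF M]] by simp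
  moreover have "rk (dual M) ?E + rk M (ground M) = card ?E + rk M T"
    using rk_dual[OF eq, of ?E] T by (simp add: double_diff)
  moreover have "rk (dual M) (?E - X) + rk M (ground M) = card (?E - X) + rk M (X \<union> T)"
  proof -
    have "ground M - (?E - X) = X \<union> T" using T X by blast
    then show ?thesis using rk_dual[OF eq, of "?E - X"] by auto
  qed
  moreover have "card X + card (?E - X) = card ?E"
  proof -
    have "finite ?E" using finite_ground[OF eq] by simp
    then show ?thesis using X by (simp add: card_Diff_subset card_mono finite_subset)
  qed
  ultimately show ?thesis by linarith
qed

text \<open>Submodularity of \<open>N\<close> for \<open>insert y X\<close> and \<open>X\<close>
  joined with \<open>T\<close>, whose intersection is \<open>X\<close> for a new \<open>y\<close>.
  The sets containing \<open>T\<close> give ranks of \<open>M'\<close>, up to the constant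
  \<open>rk N T\<close>, and the other two give ranks of \<open>M\<close>.\<close>

lemma matroid_quotient_imp_rank_quotient:
  assumes "matroid_quotient M' M"
  shows "rank_quotient M' M"
proof -
  obtain N T where N: "matroid N" "T \<subseteq> ground N" and M: "M = deletion N T" "M' = contraction N T"
    using assms unfolding matroid_quotient_def by blast
  have g: "ground M = ground N - T" "ground M' = ground N - T"
    unfolding M contraction_def by auto
  have "rk M' (insert y X) + rk M X \<le> rk M (insert y X) + rk M' X"
    if X: "X \<subseteq> ground M" "y \<in> ground M" for X y
  proof (cases "y \<in> X")
    case False
    have "insert y X \<union> (X \<union> T) = insert y X \<union> T" "insert y X \<inter> (X \<union> T) = X"
      using False X g by auto
    then have "rk N (insert y X \<union> T) + rk N X \<le> rk N (insert y X) + rk N (X \<union> T)"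
      using rk_submodular[OF N(1), of "insert y X" "X \<union> T"] by metis
    moreover have "rk M' X + rk N T = rk N (X \<union> T)" "rk M' (insert y X) + rk N T = rk N (insert y X \<union> T)"
      using rk_contraction[OF N] X g unfolding M by auto
    moreover have "rk M X = rk N X" "rk M (insert y X) = rk N (insert y X)"
      using rk_deletion[OF N(1)] X g unfolding M by auto
    ultimately show ?thesis by linarith
  qed (simp add: insert_absorb)
  then show ?thesis using g unfolding rank_quotient_def by simp
qed

section \<open>From the rank inequality back to a quotient\<close>

lemma bases_system_eqI:
  assumes "equicardinal M" "equicardinal M'" "ground M = ground M'"
    and rk: "\<And>X. X \<subseteq> ground M' \<Longrightarrow> rk M X = rk M' X"
  shows "M = M'"
proof -
  have "B \<in> bases M \<longleftrightarrow> B \<in> bases M'" for B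
  proof (cases "B \<subseteq> ground M'")
    case True
    then show ?thesis
      by (simp add: base_iff_indep[OF assms(1)] base_iff_indep[OF assms(2)] assms(3) rk
          indep_iff_rk[OF assms(1)] indep_iff_rk[OF assms(2)])
  next
    case False
    then show ?thesis
      using base_subset_ground[OF assms(1)] base_subset_ground[OF assms(2)] assms(3) by metis
  qed
  then show ?thesis using assms(3) by (intro bases_system.expand) auto
qed

lemma rank_quotient_mono:
  assumes M: "matroid M" and q: "rank_quotient M' M" and sub: "X \<subseteq> Y" "Y \<subseteq> ground M"
  shows "rk M' Y + rk M X \<le> rk M Y + rk M' X"
proof -
  have X: "X \<subseteq> ground M" using sub by simp
  have "finite Y"
    using sub(2) finite_ground[OF matroid_equicardinal[OF M]] finite_subset by blast
  then have "rk M' (X \<union> Y) + rk M X \<le> rk M (X \<union> Y) + rk M' X" using sub(2)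
  proof (induction Y rule: finite_induct)
    case (insert y Z)
    then have "rk M' (insert y (X \<union> Z)) + rk M (X \<union> Z) \<le> rk M (insert y (X \<union> Z)) + rk M' (X \<union> Z)"
      using q X unfolding rank_quotient_def by simp
    moreover have "rk M' (X \<union> Z) + rk M X \<le> rk M (X \<union> Z) + rk M' X"
      using insert.IH insert.prems by simp
    ultimately show ?case by simp
  qed simp
  then show ?thesis using sub(1) by (simp add: Un_absorb1)
qed

lemma rank_quotient_trans:
  assumes "rank_quotient M1 M2" "rank_quotient M2 M3"
  shows "rank_quotient M1 M3"
  unfolding rank_quotient_def
proof (intro conjI allI ballI impI)
  show g: "ground M1 = ground M3" using assms by (simp add: rank_quotient_def)
  fix X y assume "y \<in> ground M3" "X \<subseteq> ground M3"
  then have "rk M1 (insert y X) + rk M2 X \<le> rk M2 (insert y X) + rk M1 X"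
    "rk M2 (insert y X) + rk M3 X \<le> rk M3 (insert y X) + rk M2 X"
    using assms unfolding rank_quotient_def by auto
  then show "rk M1 (insert y X) + rk M3 X \<le> rk M3 (insert y X) + rk M1 X" by linarith
qed

lemma rank_quotient_refl: "rank_quotient M M"
  by (simp add: rank_quotient_def)

lemma rk_empty: "equicardinal M \<Longrightarrow> rk M {} = 0"
  using rk_le_card[of M "{}"] by simp

text \<open>The Higgs lift: the bases of the major \<open>N\<close> are the sets of size \<open>rk M (ground M)\<close> whose
  trace on the common ground set is independent in \<open>M\<close> and spanning in \<open>M'\<close>.\<close>

lemma rank_quotient_imp_matroid_quotient:
  fixes M M' :: "'a bases_system"
  assumes M: "matroid M" and M': "matroid M'" and q: "rank_quotient M' M"
    and inf: "infinite (UNIV :: 'a set)"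
  shows "matroid_quotient M' M"
proof -
  note eq = matroid_equicardinal[OF M] and eq' = matroid_equicardinal[OF M']
  define E where "E = ground M"
  have gM: "ground M = E" and gM': "ground M' = E"
    using q by (auto simp: E_def rank_quotient_def)
  have finE: "finite E" using finite_ground[OF eq] by (simp add: E_def)
  have qmono: "rk M' Y + rk M X \<le> rk M Y + rk M' X" if "X \<subseteq> Y" "Y \<subseteq> E" for X Y
    using rank_quotient_mono[OF M q] that by (simp add: E_def)
  have rk_le: "rk M' X \<le> rk M X" if "X \<subseteq> E" for X
    using qmono[of "{}" X] that rk_empty[OF eq] rk_empty[OF eq'] by simp
  \<comment> \<open>The size of \<open>T\<close> is the drop in rank, so that a base of
    \<open>M'\<close> together with all of \<open>T\<close> has the size of a base of
    \<open>M\<close>.\<close>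
  obtain T :: "'a set" where T: "finite T" "card T = rk M E - rk M' E" "T \<inter> E = {}"
  proof -
    have "infinite (- E)" using inf finE by (metis Compl_eq_Diff_UNIV Diff_infinite_finite)
    then obtain T where "T \<subseteq> - E" "finite T" "card T = rk M E - rk M' E"
      using infinite_arbitrarily_large by blast
    then show ?thesis by (intro that) auto
  qed
  define F where "F A \<longleftrightarrow> indep M A \<and> rk M' A = rk M' E" for A
  define N where "N = Bases_System (E \<union> T) {B. B \<subseteq> E \<union> T \<and> F (B \<inter> E) \<and> card B = rk M E}"
  have gN: "ground N = E \<union> T" by (simp add: N_def)
  have bN: "B \<in> bases N \<longleftrightarrow> B \<subseteq> E \<union> T \<and> F (B \<inter> E) \<and> card B = rk M E" for B
    by (simp add: N_def)
  have base_N: "P \<in> bases N" if P: "P \<in> bases M" for P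
  proof -
    have PE: "P \<subseteq> E" "indep M P" "card P = rk M E"
      using base_subset_ground[OF eq P] base_iff_indep[OF eq] P gM by auto
    have "rk M P = rk M E" using PE indep_iff_rk[OF eq] gM by simp
    then have "rk M' E \<le> rk M' P" using qmono[of P E] PE by simp
    then have "F P" unfolding F_def using PE rk_mono[OF eq', of P E] by simp
    then show ?thesis using PE by (auto simp: bN Int_absorb2)
  qed
  have base'_N: "B \<union> T \<in> bases N" if B: "B \<in> bases M'" for B
  proof -
    have BE: "B \<subseteq> E" "indep M' B" "card B = rk M' E"
      using base_subset_ground[OF eq' B] base_iff_indep[OF eq'] B gM' by auto
    have fin: "finite B" using BE finE finite_subset by blast
    have rkB: "rk M' B = card B" using BE indep_iff_rk[OF eq'] gM' by simp
    then have "rk M B = card B" using rk_le[OF BE(1)] rk_le_card[OF eq fin] by simp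
    then have "F B" using BE rkB indep_iff_rk[OF eq] gM by (simp add: F_def)
    moreover have "(B \<union> T) \<inter> E = B" using T BE by blast
    moreover have "card (B \<union> T) = rk M E"
      using T BE fin rk_le[of E] by (subst card_Un_disjoint) auto
    ultimately show ?thesis using BE by (auto simp: bN)
  qed
  have matN: "matroid N"
    unfolding matroid_def
  proof (intro conjI ballI)
    show "finite (ground N)" using finE T by (simp add: gN)
    show "bases N \<noteq> {}" using base_N eq unfolding equicardinal_def by auto
    show "B \<subseteq> ground N" if "B \<in> bases N" for B using that bN gN by simp
    fix A B x assume A: "A \<in> bases N" and B: "B \<in> bases N" and x: "x \<in> A - B"
    let ?A = "(A - {x}) \<inter> E"
    have fin: "finite A" "finite B" using A B finE T bN by (meson finite_UnI finite_subset)+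
    have indA: "indep M ?A" using A bN indep_mono[OF eq, of "A \<inter> E" ?A] by (auto simp: F_def)
    have spanB: "rk M' (B \<inter> E) = rk M' E" and indB: "indep M (B \<inter> E)"
      using B bN by (auto simp: F_def)
    have rkA: "rk M' E \<le> Suc (rk M' ?A)"
    proof -
      have "rk M' E = rk M' (A \<inter> E)" using A bN by (simp add: F_def)
      also have "\<dots> \<le> rk M' (insert x ?A)" by (intro rk_mono[OF eq']) auto
      also have "\<dots> \<le> Suc (rk M' ?A)" by (rule rk_insert_le[OF eq'])
      finally show ?thesis .
    qed
    \<comment> \<open>If removing \<open>x\<close> destroys spanning in \<open>M'\<close>, choose
      \<open>y\<close> in \<open>B\<close> to restore it; the quotient inequality then makes the
      rank in \<open>M\<close> grow too, so independence comes for free. If spanning survives, only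
      independence matters: a \<open>y\<close> in \<open>T\<close> leaves the trace on
      \<open>E\<close> alone, and when no such \<open>y\<close> is available, counting shows that
      the trace of \<open>B\<close> is larger and augmentation applies.\<close>
    have "\<exists>y\<in>B - A. F (insert y (A - {x}) \<inter> E)"
    proof (cases "rk M' ?A = rk M' E")
      case False
      then have lt: "rk M' ?A < rk M' E" using rk_mono[OF eq', of ?A E] by simp
      have "\<exists>y\<in>B \<inter> E. rk M' (insert y ?A) \<noteq> rk M' ?A"
      proof (rule ccontr)
        assume "\<not> ?thesis"
        then have "rk M' (?A \<union> (B \<inter> E)) = rk M' ?A" by (intro rk_Un_eqI[OF M']) simp
        moreover have "rk M' (B \<inter> E) \<le> rk M' (?A \<union> (B \<inter> E))" by (intro rk_mono[OF eq']) auto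
        ultimately show False using spanB lt by simp
      qed
      then obtain y where y: "y \<in> B \<inter> E" "rk M' (insert y ?A) \<noteq> rk M' ?A" by blast
      then have grow: "rk M' (insert y ?A) = Suc (rk M' ?A)"
        using rk_insert_le[OF eq', of y ?A] rk_mono[OF eq' subset_insertI, of ?A y] by linarith
      have "y \<notin> ?A" using y(2) by (metis insert_absorb)
      moreover have "y \<noteq> x" using x y by blast
      ultimately have yA: "y \<in> B - A" using y by blast
      have ins: "insert y (A - {x}) \<inter> E = insert y ?A" using y by blast
      have "rk M' (insert y ?A) + rk M ?A \<le> rk M (insert y ?A) + rk M' ?A"
        using qmono[of ?A "insert y ?A"] y by auto
      moreover have "rk M ?A = card ?A" using indA indep_iff_rk[OF eq, of ?A] gM by simp
      moreover have "card (insert y ?A) = Suc (card ?A)" using \<open>y \<notin> ?A\<close> fin by simp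
      moreover have "rk M (insert y ?A) \<le> card (insert y ?A)"
        using fin by (intro rk_le_card[OF eq]) simp
      ultimately have "rk M (insert y ?A) = card (insert y ?A)" using grow by linarith
      then have "indep M (insert y ?A)" using y indep_iff_rk[OF eq, of "insert y ?A"] gM by simp
      moreover have "rk M' (insert y ?A) = rk M' E"
        using grow rkA lt by simp
      ultimately have "F (insert y (A - {x}) \<inter> E)" unfolding F_def ins by simp
      then show ?thesis using yA by blast
    next
      case True
      show ?thesis
      proof (cases "\<exists>y\<in>B - A. y \<in> T")
        case True
        then obtain y where y: "y \<in> B - A" "y \<in> T" by blast
        then have "insert y (A - {x}) \<inter> E = ?A" using T by blast
        then have "F (insert y (A - {x}) \<inter> E)"
          unfolding F_def using indA \<open>rk M' ?A = rk M' E\<close> by simp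
        then show ?thesis using y by blast
      next
        case False
        then have "B \<inter> T \<subseteq> (A - {x}) \<inter> T" using x by blast
        then have "card (B \<inter> T) \<le> card ((A - {x}) \<inter> T)" using fin by (intro card_mono) auto
        moreover have split: "card (C \<inter> E) + card (C \<inter> T) = card C" if "C \<subseteq> E \<union> T" for C
        proof -
          have "finite (C \<inter> E)" "finite (C \<inter> T)" "(C \<inter> E) \<inter> (C \<inter> T) = {}" "C \<inter> E \<union> C \<inter> T = C"
            using that finE T by auto
          then show ?thesis by (metis card_Un_disjoint)
        qed
        moreover have "A - {x} \<subseteq> E \<union> T" "B \<subseteq> E \<union> T" using A B bN by auto
        then have "card (B \<inter> E) + card (B \<inter> T) = card B"
          "card ?A + card ((A - {x}) \<inter> T) = card (A - {x})"
          by (simp_all only: split)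
        moreover have "card (A - {x}) < card A" using x fin by (intro psubset_card_mono) auto
        moreover have "card A = card B" using A B bN by simp
        ultimately have "card ?A < card (B \<inter> E)" by linarith
        then obtain y where y: "y \<in> B \<inter> E - ?A" "indep M (insert y ?A)"
          using indep_augment[OF M indA indB] by blast
        have ins: "insert y (A - {x}) \<inter> E = insert y ?A" using y by blast
        have "rk M' (insert y ?A) = rk M' E"
          using True rk_mono[OF eq' subset_insertI, of ?A y] rk_mono[OF eq', of "insert y ?A" E] y
          by simp
        then have "F (insert y (A - {x}) \<inter> E)" unfolding F_def ins using y by simp
        moreover have "y \<in> B - A" using y x by blast
        ultimately show ?thesis by blast
      qed
    qed
    then obtain y where y: "y \<in> B - A" "F (insert y (A - {x}) \<inter> E)" by blast
    have "card (insert y (A - {x})) = card A"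
    proof -
      have "card (insert y (A - {x})) = Suc (card (A - {x}))" using y fin by simp
      also have "\<dots> = card A" using x fin by (intro card_Suc_Diff1) auto
      finally show ?thesis .
    qed
    then have "insert y (A - {x}) \<in> bases N" using y A B bN by auto
    then show "\<exists>y\<in>B - A. insert y (A - {x}) \<in> bases N" using y(1) by blast
  qed
  note eqN = matroid_equicardinal[OF matN]
  have gd: "ground N - T = E" using gN T by blast
  have rkN: "rk N X = rk M X" if X: "X \<subseteq> E" for X
  proof (rule antisym)
    show "rk N X \<le> rk M X"
    proof (rule rk_leI[OF eqN])
      fix B assume "B \<in> bases N"
      then have "indep M (B \<inter> E)" by (simp add: bN F_def)
      then have "indep M (B \<inter> X)" using indep_mono[OF eq, of "B \<inter> E" "B \<inter> X"] X by blast
      then show "card (B \<inter> X) \<le> rk M X" using card_indep_le_rk[OF eq, of "B \<inter> X" X] by simp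
    qed
    obtain P where "P \<in> bases M" "card (P \<inter> X) = rk M X" by (rule rk_attained[OF eq])
    then show "rk M X \<le> rk N X" using card_base_Int_le_rk[OF eqN base_N, of P X] by simp
  qed
  have rkNT: "rk N (X \<union> T) = rk M' X + card T" if X: "X \<subseteq> E" for X
  proof (rule antisym)
    show "rk N (X \<union> T) \<le> rk M' X + card T"
    proof (rule rk_leI[OF eqN])
      fix B assume B: "B \<in> bases N"
      then have ind: "indep M (B \<inter> E)" and sp: "rk M' (B \<inter> E) = rk M' E" and BET: "B \<subseteq> E \<union> T"
        by (auto simp: bN F_def)
      have finB: "finite B" using finite_base[OF eqN B] .
      \<comment> \<open>The excess of the trace on \<open>X\<close> over its rank in
        \<open>M'\<close> is at most that of the trace on \<open>E\<close>. The latter is the number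
        of elements of \<open>T\<close> missing from \<open>B\<close>.\<close>
      have "rk M' (B \<inter> E) + rk M (B \<inter> X) \<le> rk M (B \<inter> E) + rk M' (B \<inter> X)"
        using X by (intro qmono) auto
      moreover have "rk M (B \<inter> E) = card (B \<inter> E)" using ind indep_iff_rk[OF eq] gM by simp
      moreover have "rk M (B \<inter> X) = card (B \<inter> X)"
        using indep_mono[OF eq ind, of "B \<inter> X"] indep_iff_rk[OF eq, of "B \<inter> X"] gM X by auto
      moreover have "rk M' (B \<inter> X) \<le> rk M' X" by (intro rk_mono[OF eq']) auto
      moreover have "card B = rk M E" using B bN by simp
      moreover have "card B = card (B \<inter> E) + card (B \<inter> T)"
        using finB T BET by (subst card_Un_disjoint[symmetric]) (auto intro!: arg_cong[of _ _ card])
      moreover have "card (B \<inter> (X \<union> T)) = card (B \<inter> X) + card (B \<inter> T)"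
        using finB T X by (subst card_Un_disjoint[symmetric]) (auto intro!: arg_cong[of _ _ card])
      ultimately show "card (B \<inter> (X \<union> T)) \<le> rk M' X + card T"
        using sp T(2) rk_le[of E] by simp
    qed
    obtain B where B: "B \<in> bases M'" "card (B \<inter> X) = rk M' X" by (rule rk_attained[OF eq'])
    have "finite (B \<inter> X)" using finite_base[OF eq' B(1)] by simp
    moreover have "(B \<inter> X) \<inter> T = {}" "(B \<union> T) \<inter> (X \<union> T) = (B \<inter> X) \<union> T" using T X by auto
    ultimately have "card ((B \<union> T) \<inter> (X \<union> T)) = rk M' X + card T"
      using B T card_Un_disjoint by metis
    then show "rk M' X + card T \<le> rk N (X \<union> T)"
      using card_base_Int_le_rk[OF eqN base'_N[OF B(1)], of "X \<union> T"] by simp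
  qed
  have "deletion N T = M"
  proof (rule bases_system_eqI[OF equicardinal_deletion[OF matN] eq])
    show "ground (deletion N T) = ground M" using gd gM by simp
    show "rk (deletion N T) X = rk M X" if "X \<subseteq> ground M" for X
      using rk_deletion[OF matN, of X T] rkN that gd gM by simp
  qed
  moreover have "contraction N T = M'"
  proof (rule bases_system_eqI[OF _ eq'])
    show "equicardinal (contraction N T)"
      unfolding contraction_def
      by (rule equicardinal_dual[OF equicardinal_deletion[OF matroid_dual[OF matN]]])
    show "ground (contraction N T) = ground M'" using gd gM' by (simp add: contraction_def)
    show "rk (contraction N T) X = rk M' X" if "X \<subseteq> ground M'" for X
      using rk_contraction[OF matN, of T X] rkNT[of X] rkNT[of "{}"] rk_empty[OF eq'] that gd gM' gN
      by simp
  qed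
  moreover have "T \<subseteq> ground N" by (simp add: gN)
  ultimately show ?thesis unfolding matroid_quotient_def using matN by metis
qed

section \<open>Symmetric exchange for lattice path matroids\<close>

text \<open>The height of the lattice path of \<open>S\<close> after \<open>t\<close> steps. It is
  also the 1-based index of \<open>t\<close> in \<open>S\<close> when \<open>t\<close> belongs to
  \<open>S\<close>.\<close>

definition cnt :: "nat set \<Rightarrow> nat \<Rightarrow> nat" where
  "cnt S t = card (S \<inter> {..t})"

lemma cnt_0: "0 \<notin> S \<Longrightarrow> cnt S 0 = 0"
  by (auto simp: cnt_def)

lemma cnt_Suc: "cnt S (Suc t) = cnt S t + (if Suc t \<in> S then 1 else 0)"
  by (simp add: cnt_def atMost_Suc Int_insert_right)

lemma cnt_step: "0 < t \<Longrightarrow> cnt S t = cnt S (t - 1) + (if t \<in> S then 1 else 0)"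
  using cnt_Suc[of S "t - 1"] by simp

lemma cnt_insert: "y \<notin> S \<Longrightarrow> cnt (insert y S) t = cnt S t + (if y \<le> t then 1 else 0)"
  by (simp add: cnt_def Int_insert_left)

lemma cnt_remove: "x \<in> S \<Longrightarrow> cnt (S - {x}) t + (if x \<le> t then 1 else 0) = cnt S t"
  using cnt_insert[of x "S - {x}" t] by (simp add: insert_absorb)

lemma cnt_swap:
  assumes "x \<in> S" "y \<notin> S"
  shows "cnt (insert y (S - {x})) t + (if x \<le> t then 1 else 0) = cnt S t + (if y \<le> t then 1 else 0)"
proof -
  have "y \<notin> S - {x}" using assms by simp
  then show ?thesis using cnt_insert[of y "S - {x}" t] cnt_remove[OF assms(1), of t] by linarith
qed

lemma cnt_mono: "s \<le> t \<Longrightarrow> cnt S s \<le> cnt S t"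
  unfolding cnt_def by (intro card_mono) auto

lemma cnt_add_le: "s \<le> t \<Longrightarrow> cnt S t \<le> cnt S s + (t - s)"
proof (induction "t - s" arbitrary: t)
  case (Suc d)
  then have "cnt S (t - 1) \<le> cnt S s + (t - 1 - s)" by (intro Suc.hyps) auto
  then show ?case using cnt_step[of t S] Suc.hyps(2) by auto
qed simp

lemma cnt_le_card: "finite S \<Longrightarrow> cnt S t \<le> card S"
  unfolding cnt_def by (intro card_mono) auto

lemma cnt_eq_card: "S \<subseteq> {1..n} \<Longrightarrow> n \<le> t \<Longrightarrow> cnt S t = card S"
  unfolding cnt_def by (rule arg_cong[of _ _ card]) auto

lemma cnt_le_self: "S \<subseteq> {1..n} \<Longrightarrow> cnt S t \<le> t"
  using cnt_add_le[of 0 t S] cnt_0[of S] by fastforce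

lemma eq_if_cnt_eq:
  assumes "0 \<notin> A" "0 \<notin> B" "\<And>t. cnt A t = cnt B t"
  shows "A = B"
proof -
  have "t \<in> A \<longleftrightarrow> t \<in> B" for t
  proof (cases t)
    case (Suc s)
    then show ?thesis using cnt_Suc[of A s] cnt_Suc[of B s] assms(3)[of s] assms(3)[of "Suc s"]
      by (auto split: if_splits)
  qed (use assms in auto)
  then show ?thesis by blast
qed

text \<open>Elements up to \<open>t\<close> occupy an initial segment of positions. The enumeration
  and the counting function are thus adjoint, which converts comparisons of \<open>i\<close>-th
  elements into comparisons of heights.\<close>

lemma sorted_list_nth_le_iff:
  assumes A: "finite A" and i: "i < card A"
  shows "sorted_list_of_set A ! i \<le> t \<longleftrightarrow> i < cnt A t"
proof -
  let ?xs = "sorted_list_of_set A"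
  let ?J = "{j. j < card A \<and> ?xs ! j \<le> t}"
  have len: "length ?xs = card A" by simp
  have mono: "?xs ! j \<le> ?xs ! k" if "j \<le> k" "k < card A" for j k
    using that len by (simp add: sorted_nth_mono)
  have "A \<inter> {..t} = (!) ?xs ` ?J"
  proof -
    have "v \<in> A \<longleftrightarrow> (\<exists>j<card A. ?xs ! j = v)" for v
      using in_set_conv_nth[of v ?xs] by (simp only: set_sorted_list_of_set[OF A] len)
    then show ?thesis by (simp add: set_eq_iff image_iff) metis
  qed
  moreover have "inj_on ((!) ?xs) ?J"
    using distinct_sorted_list_of_set[of A] len by (auto simp: inj_on_def nth_eq_iff_index_eq)
  ultimately have c: "cnt A t = card ?J" unfolding cnt_def by (simp add: card_image)
  show ?thesis
  proof
    assume "?xs ! i \<le> t"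
    then have "{..i} \<subseteq> ?J" using i mono by (auto intro: order_trans)
    then have "card {..i} \<le> card ?J" by (intro card_mono) auto
    then show "i < cnt A t" using c by simp
  next
    assume "i < cnt A t"
    show "?xs ! i \<le> t"
    proof (rule ccontr)
      assume gt: "\<not> ?xs ! i \<le> t"
      have "j < i" if "j \<in> ?J" for j
      proof (rule ccontr)
        assume "\<not> j < i"
        then have "?xs ! i \<le> ?xs ! j" using that mono by simp
        then show False using that gt by simp
      qed
      then have "?J \<subseteq> {..<i}" by blast
      then have "card ?J \<le> card {..<i}" by (intro card_mono) auto
      then show False using \<open>i < cnt A t\<close> c by simp
    qed
  qed
qed

text \<open>The inequality turns around because earlier North steps make a path higher.\<close>

lemma path_le_iff_cnt:
  assumes A: "finite A" and B: "finite B"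
  shows "path_le A B \<longleftrightarrow> card A = card B \<and> (\<forall>t. cnt B t \<le> cnt A t)"
proof -
  have "(\<forall>i<card A. sorted_list_of_set A ! i \<le> sorted_list_of_set B ! i) \<longleftrightarrow> (\<forall>t. cnt B t \<le> cnt A t)"
    if eq: "card A = card B"
  proof
    assume le: "\<forall>i<card A. sorted_list_of_set A ! i \<le> sorted_list_of_set B ! i"
    show "\<forall>t. cnt B t \<le> cnt A t"
    proof (intro allI, rule ccontr)
      fix t assume "\<not> cnt B t \<le> cnt A t"
      then have lt: "cnt A t < cnt B t" by simp
      \<comment> \<open>Counting positions from 0, \<open>cnt A t\<close> is the position of the
        first element of \<open>A\<close> beyond \<open>t\<close>, while the element of
        \<open>B\<close> at this position is still at most \<open>t\<close>.\<close>
      then have i: "cnt A t < card A" using cnt_le_card[OF B, of t] eq by simp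
      then have "sorted_list_of_set B ! cnt A t \<le> t"
        using sorted_list_nth_le_iff[OF B, of "cnt A t" t] eq lt by simp
      then have "sorted_list_of_set A ! cnt A t \<le> t" using le i order_trans by blast
      then show False using sorted_list_nth_le_iff[OF A i] by simp
    qed
  next
    assume le: "\<forall>t. cnt B t \<le> cnt A t"
    show "\<forall>i<card A. sorted_list_of_set A ! i \<le> sorted_list_of_set B ! i"
    proof (intro allI impI)
      fix i assume i: "i < card A"
      let ?t = "sorted_list_of_set B ! i"
      have "i < cnt B ?t" using sorted_list_nth_le_iff[OF B, of i ?t] i eq by simp
      then have "i < cnt A ?t" using le by (meson less_le_trans)
      then show "sorted_list_of_set A ! i \<le> ?t" using sorted_list_nth_le_iff[OF A i] by simp
    qed
  qed
  then show ?thesis unfolding path_le_def list_all2_conv_all_nth by auto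
qed

section \<open>Lattice path matroids through heights\<close>

lemma lpm_pair_iff:
  "lpm_pair n U L \<longleftrightarrow> U \<subseteq> {1..n} \<and> L \<subseteq> {1..n} \<and> card U = card L \<and> (\<forall>t. cnt L t \<le> cnt U t)"
proof (cases "U \<subseteq> {1..n} \<and> L \<subseteq> {1..n}")
  case True
  then have "finite U" "finite L" using finite_subset by auto
  then show ?thesis using True path_le_iff_cnt unfolding lpm_pair_def by blast
qed (auto simp: lpm_pair_def)

lemma ground_lpm [simp]: "ground (lpm n U L) = {1..n}"
  by (simp add: lpm_def)

text \<open>At \<open>t = n\<close> the two bounds coincide and fix the size of \<open>B\<close>, so
  the height bounds alone describe the bases.\<close>

lemma bases_lpm:
  assumes "lpm_pair n U L"
  shows "B \<in> bases (lpm n U L) \<longleftrightarrow> B \<subseteq> {1..n} \<and> (\<forall>t. cnt L t \<le> cnt B t \<and> cnt B t \<le> cnt U t)"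
proof (cases "B \<subseteq> {1..n}")
  case True
  have UL: "U \<subseteq> {1..n}" "L \<subseteq> {1..n}" "card U = card L" using assms lpm_pair_iff by auto
  have fin: "finite U" "finite L" "finite B" using UL(1,2) True by (simp_all only: finite_subset[OF _ finite_atLeastAtMost])
  have "card B = card U" if "\<forall>t. cnt L t \<le> cnt B t \<and> cnt B t \<le> cnt U t"
    using that[rule_format, of n] UL cnt_eq_card[of _ n n] True by simp
  then show ?thesis using True UL(3) by (auto simp: lpm_def path_le_iff_cnt fin)
qed (simp add: lpm_def)

lemma lpm_upper_base: "lpm_pair n U L \<Longrightarrow> U \<in> bases (lpm n U L)"
  and lpm_lower_base: "lpm_pair n U L \<Longrightarrow> L \<in> bases (lpm n U L)"
  by (auto simp: bases_lpm) (auto simp: lpm_pair_iff)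

text \<open>\<open>U\<close> and \<open>L\<close> are themselves bases, the pointwise highest and
  lowest ones, so each description bounds the other.\<close>

lemma lpm_inject:
  assumes "lpm_pair n U L" "lpm_pair n U' L'" "lpm n U L = lpm n U' L'"
  shows "U = U' \<and> L = L'"
proof -
  have "0 \<notin> U" "0 \<notin> L" "0 \<notin> U'" "0 \<notin> L'" using assms(1,2) unfolding lpm_pair_def by auto
  moreover have "U \<in> bases (lpm n U' L')" "L \<in> bases (lpm n U' L')"
      "U' \<in> bases (lpm n U L)" "L' \<in> bases (lpm n U L)"
    using lpm_upper_base[OF assms(1)] lpm_lower_base[OF assms(1)]
      lpm_upper_base[OF assms(2)] lpm_lower_base[OF assms(2)] assms(3) by simp_all
  then have "cnt U t = cnt U' t" "cnt L t = cnt L' t" for t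
    by (simp_all add: bases_lpm assms(1,2) antisym)
  ultimately show ?thesis using eq_if_cnt_eq by metis
qed

text \<open>For a height difference \<open>D\<close>, an upward crossing at \<open>x\<close> means
  that \<open>x\<close> is a step of the first path only; staying below \<open>d\<close> before
  \<open>x\<close> later provides the room for the exchange. Integers are used because
  \<open>D\<close> can be negative.\<close>

lemma first_reach:
  fixes D :: "nat \<Rightarrow> int"
  assumes "D y < d" "d \<le> D m" "y \<le> m"
  obtains x where "y < x" "x \<le> m" "D (x - 1) < d" "d \<le> D x" "\<And>t. y \<le> t \<Longrightarrow> t < x \<Longrightarrow> D t < d"
proof -
  define x where "x = (LEAST x. y \<le> x \<and> d \<le> D x)"
  have x: "y \<le> x \<and> d \<le> D x" unfolding x_def by (rule LeastI[of _ m]) (use assms in simp)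
  have least: "D t < d" if "y \<le> t" "t < x" for t
    using not_less_Least[of t "\<lambda>x. y \<le> x \<and> d \<le> D x"] that unfolding x_def by auto
  have "y < x" using x assms(1) by (cases "y = x") auto
  moreover have "x \<le> m" unfolding x_def by (rule Least_le) (use assms in simp)
  moreover have "D (x - 1) < d" using \<open>y < x\<close> by (intro least) auto
  ultimately show ?thesis using x least by (intro that) auto
qed

text \<open>Counterpart looking backwards from \<open>w\<close>: either the last crossing happens at
  the final step or it is inherited from the shorter range.\<close>

lemma last_reach:
  fixes D :: "nat \<Rightarrow> int"
  assumes "D 0 < d" "d \<le> D w"
  shows "\<exists>x. 0 < x \<and> x \<le> w \<and> D (x - 1) < d \<and> d \<le> D x \<and> (\<forall>t. x \<le> t \<and> t \<le> w \<longrightarrow> d \<le> D t)"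
  using assms(2)
proof (induction w)
  case 0
  then show ?case using assms(1) by simp
next
  case (Suc w)
  show ?case
  proof (cases "D w < d")
    case True
    then show ?thesis using Suc.prems by (intro exI[of _ "Suc w"]) (auto simp: le_antisym)
  next
    case False
    then obtain x where "0 < x" "x \<le> w" "D (x - 1) < d" "d \<le> D x"
      "\<forall>t. x \<le> t \<and> t \<le> w \<longrightarrow> d \<le> D t" using Suc.IH by auto
    then show ?thesis using Suc.prems by (intro exI[of _ x]) (auto simp: le_Suc_eq)
  qed
qed

text \<open>The index of \<open>b\<close> in \<open>L\<close> is \<open>cnt L b\<close>; the paper's inequality \<open>u\<^sub>j - l\<^sub>i \<le> j - i\<close> is rearranged
  so that no subtraction occurs.\<close>

definition good_pair :: "nat set \<Rightarrow> nat set \<Rightarrow> nat \<Rightarrow> nat \<Rightarrow> bool" where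
  "good_pair U L b a \<longleftrightarrow> a \<in> U \<and> b \<in> L \<and> cnt L b \<le> cnt U a \<and> a + cnt L b \<le> b + cnt U a"

text \<open>The removals can spoil the order of the paths only for \<open>a <= t < b\<close>, where
  \<open>U\<close> has been lowered and \<open>L\<close> has not. There
  \<open>cnt L t < cnt L b <= cnt U a <= cnt U t\<close> leaves one unit of room.\<close>

lemma good_pair_lpm_pair:
  assumes UL: "lpm_pair n U L" and g: "good_pair U L b a"
  shows "lpm_pair n (U - {a}) (L - {b})"
proof -
  have ab: "a \<in> U" "b \<in> L" "cnt L b \<le> cnt U a" using g by (auto simp: good_pair_def)
  have le: "cnt L t \<le> cnt U t" for t using UL lpm_pair_iff by blast
  have pos: "0 < b" using UL ab unfolding lpm_pair_def by auto
  have "cnt (L - {b}) t \<le> cnt (U - {a}) t" for t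
  proof -
    have "cnt L t < cnt U t" if "a \<le> t" "t < b"
    proof -
      have "cnt L t \<le> cnt L (b - 1)" using that by (intro cnt_mono) simp
      also have "\<dots> < cnt L b" using cnt_step[OF pos, of L] ab by simp
      also have "\<dots> \<le> cnt U t" using ab cnt_mono[OF that(1), of U] by simp
      finally show ?thesis .
    qed
    then show ?thesis using cnt_remove[OF ab(1), of t] cnt_remove[OF ab(2), of t] le[of t]
      by (auto split: if_splits)
  qed
  moreover have "card (U - {a}) = card (L - {b})"
    using ab UL by (auto simp: lpm_pair_iff card_Diff_singleton)
  ultimately show ?thesis using UL by (auto simp: lpm_pair_iff)
qed

text \<open>Let \<open>D t\<close> be the height difference of the paths \<open>P\<close> and \<open>Q\<close>. It drops from \<open>d\<close> to
  \<open>d - 1\<close> at \<open>y\<close>, so \<open>x\<close> is found as the next return to \<open>d\<close> after \<open>y\<close> (possible if \<open>d \<le> 1\<close>) or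
  as the last arrival at \<open>d\<close> before \<open>y\<close> (possible if \<open>d \<ge> 1\<close>). Only for \<open>d = 1\<close> can an exchange
  leave the region between the paths, and goodness of the pair excludes that both do.\<close>

lemma lpm_symmetric_exchange:
  assumes UL: "lpm_pair n U L" and UL': "lpm_pair n U' L'"
    and rel: "U' = U \<and> L' = L \<or> (\<exists>a b. good_pair U L b a \<and> U' = U - {a} \<and> L' = L - {b})"
    and P: "P \<in> bases (lpm n U L)" and Q: "Q \<in> bases (lpm n U' L')" and y: "y \<in> Q - P"
  shows "\<exists>x\<in>P - Q. insert y (P - {x}) \<in> bases (lpm n U L) \<and> insert x (Q - {y}) \<in> bases (lpm n U' L')"
proof -
  have Pn: "P \<subseteq> {1..n}" and Qn: "Q \<subseteq> {1..n}" using P Q bases_lpm UL UL' by auto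
  have Pb: "cnt L t \<le> cnt P t" "cnt P t \<le> cnt U t" for t using P bases_lpm UL by auto
  have Qb: "cnt L' t \<le> cnt Q t" "cnt Q t \<le> cnt U' t" for t using Q bases_lpm UL' by auto
  have yn: "0 < y" "y \<le> n" using y Qn by auto
  define D where "D t = int (cnt P t) - int (cnt Q t)" for t
  define d where "d = D (y - 1)"
  have Dy: "D y = d - 1"
    unfolding d_def D_def using cnt_step[OF yn(1), of P] cnt_step[OF yn(1), of Q] y by simp
  have "0 \<notin> P" "0 \<notin> Q" using Pn Qn by auto
  then have D0: "D 0 = 0" by (simp add: D_def cnt_0)
  have up: "x \<in> P - Q" if "0 < x" "D (x - 1) < c" "c \<le> D x" for x c
    using that cnt_step[OF that(1), of P] cnt_step[OF that(1), of Q]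
    unfolding D_def by (auto split: if_splits)
  \<comment> \<open>With \<open>y < x\<close>, the exchange raises \<open>P\<close> and lowers
    \<open>Q\<close> by one exactly on \<open>y <= t < x\<close>; \<open>room\<close> keeps both
    within their bounds.\<close>
  have right: ?thesis if x: "x \<in> P - Q" "y < x"
    and room: "\<And>t. y \<le> t \<Longrightarrow> t < x \<Longrightarrow> cnt P t < cnt U t \<and> cnt L' t < cnt Q t" for x
  proof -
    have "cnt L t \<le> cnt (insert y (P - {x})) t \<and> cnt (insert y (P - {x})) t \<le> cnt U t" for t
      using cnt_swap[of x P y t] x y Pb[of t] room[of t] by (auto split: if_splits)
    moreover have "cnt L' t \<le> cnt (insert x (Q - {y})) t \<and> cnt (insert x (Q - {y})) t \<le> cnt U' t" for t
      using cnt_swap[of y Q x t] x y Qb[of t] room[of t] by (auto split: if_splits)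
    ultimately show ?thesis
      using x(1) y Pn Qn by (intro bexI[of _ x]) (auto simp: bases_lpm UL UL')
  qed
  \<comment> \<open>Mirror image: on \<open>x <= t < y\<close> the path \<open>P\<close> drops by
    one and \<open>Q\<close> rises by one.\<close>
  have left: ?thesis if x: "x \<in> P - Q" "x < y"
    and room: "\<And>t. x \<le> t \<Longrightarrow> t < y \<Longrightarrow> cnt L t < cnt P t \<and> cnt Q t < cnt U' t" for x
  proof -
    have "cnt L t \<le> cnt (insert y (P - {x})) t \<and> cnt (insert y (P - {x})) t \<le> cnt U t" for t
      using cnt_swap[of x P y t] x y Pb[of t] room[of t] by (auto split: if_splits)
    moreover have "cnt L' t \<le> cnt (insert x (Q - {y})) t \<and> cnt (insert x (Q - {y})) t \<le> cnt U' t" for t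
      using cnt_swap[of y Q x t] x y Qb[of t] room[of t] by (auto split: if_splits)
    ultimately show ?thesis
      using x(1) y Pn Qn by (intro bexI[of _ x]) (auto simp: bases_lpm UL UL')
  qed
  have right_x: "\<exists>x. x \<in> P - Q \<and> y < x \<and> (\<forall>t. y \<le> t \<and> t < x \<longrightarrow> D t < d)" if dn: "d \<le> D n"
  proof -
    obtain x where "y < x" "x \<le> n" "D (x - 1) < d" "d \<le> D x" "\<And>t. y \<le> t \<Longrightarrow> t < x \<Longrightarrow> D t < d"
      by (rule first_reach[of D y d n]) (use Dy dn yn in auto)
    then show ?thesis using up[of x d] by auto
  qed
  have left_x: "\<exists>x. x \<in> P - Q \<and> x < y \<and> (\<forall>t. x \<le> t \<and> t < y \<longrightarrow> d \<le> D t)" if d1: "1 \<le> d"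
  proof -
    obtain x where "0 < x" "x \<le> y - 1" "D (x - 1) < d" "d \<le> D x"
      "\<forall>t. x \<le> t \<and> t \<le> y - 1 \<longrightarrow> d \<le> D t"
      using last_reach[of D d "y - 1"] d1 D0 d_def by auto
    then show ?thesis using up[of x d] yn by (intro exI[of _ x]) auto
  qed
  have ends: "cnt L n = cnt U n" if "lpm_pair n U L" for U L
    using that cnt_eq_card[of U n n] cnt_eq_card[of L n n] by (simp add: lpm_pair_iff)
  have cP: "cnt P n = cnt U n" using Pb[of n] ends[OF UL] by simp
  have cQ: "cnt Q n = cnt U' n" using Qb[of n] ends[OF UL'] by simp
  show ?thesis
    using rel
  proof
    assume same: "U' = U \<and> L' = L"
    then have Dn: "D n = 0" using cP cQ by (simp add: D_def)
    show ?thesis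
    proof (cases "d \<le> 0")
      case True
      then obtain x where x: "x \<in> P - Q" "y < x" "\<forall>t. y \<le> t \<and> t < x \<longrightarrow> D t < d"
        using right_x Dn by auto
      show ?thesis
      proof (rule right[OF x(1,2)])
        fix t assume "y \<le> t" "t < x"
        then have "D t < d" using x(3) by simp
        then show "cnt P t < cnt U t \<and> cnt L' t < cnt Q t"
          using True same Pb[of t] Qb[of t] unfolding D_def by auto
      qed
    next
      case False
      then obtain x where x: "x \<in> P - Q" "x < y" "\<forall>t. x \<le> t \<and> t < y \<longrightarrow> d \<le> D t"
        using left_x by auto
      show ?thesis
      proof (rule left[OF x(1,2)])
        fix t assume "x \<le> t" "t < y"
        then have "d \<le> D t" using x(3) by simp
        then show "cnt L t < cnt P t \<and> cnt Q t < cnt U' t"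
          using False same Pb[of t] Qb[of t] unfolding D_def by auto
      qed
    qed
  next
    assume "\<exists>a b. good_pair U L b a \<and> U' = U - {a} \<and> L' = L - {b}"
    then obtain a b where g: "good_pair U L b a" and U': "U' = U - {a}" and L': "L' = L - {b}"
      by blast
    have ab: "a \<in> U" "b \<in> L" and good: "cnt L b \<le> cnt U a" "a + cnt L b \<le> b + cnt U a"
      using g by (auto simp: good_pair_def)
    have pos: "0 < a" "a \<le> n" "0 < b" using UL ab unfolding lpm_pair_def by auto
    have u': "cnt U' t + (if a \<le> t then 1 else 0) = cnt U t" for t
      unfolding U' by (rule cnt_remove[OF ab(1)])
    have l': "cnt L' t + (if b \<le> t then 1 else 0) = cnt L t" for t
      unfolding L' by (rule cnt_remove[OF ab(2)])
    \<comment> \<open>One pair is removed, so \<open>Q\<close> has one element less than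
      \<open>P\<close> and \<open>D\<close> ends at 1. This guarantees a return to level
      \<open>d\<close> whenever \<open>d\<close> is at most 1.\<close>
    have Dn: "D n = 1" using cP cQ u'[of n] pos by (simp add: D_def)
    consider "d \<le> 0" | "d \<ge> 2" | "d = 1" by linarith
    then show ?thesis
    proof cases
      case 1
      then obtain x where x: "x \<in> P - Q" "y < x" "\<forall>t. y \<le> t \<and> t < x \<longrightarrow> D t < d"
        using right_x Dn by auto
      show ?thesis
      proof (rule right[OF x(1,2)])
        fix t assume "y \<le> t" "t < x"
        then have "D t < 0" using x(3)[rule_format, of t] 1 by simp
        then show "cnt P t < cnt U t \<and> cnt L' t < cnt Q t"
          using Pb[of t] Qb[of t] u'[of t] l'[of t] unfolding D_def by (auto split: if_splits)
      qed
    next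
      case 2
      then obtain x where x: "x \<in> P - Q" "x < y" "\<forall>t. x \<le> t \<and> t < y \<longrightarrow> d \<le> D t"
        using left_x by auto
      show ?thesis
      proof (rule left[OF x(1,2)])
        fix t assume "x \<le> t" "t < y"
        then have "2 \<le> D t" using x(3)[rule_format, of t] 2 by simp
        then show "cnt L t < cnt P t \<and> cnt Q t < cnt U' t"
          using Pb[of t] Qb[of t] u'[of t] l'[of t] unfolding D_def by (auto split: if_splits)
      qed
    next
      case 3
      obtain x where x: "x \<in> P - Q" "y < x" "\<forall>t. y \<le> t \<and> t < x \<longrightarrow> D t < 1"
        using right_x Dn 3 by auto
      obtain x' where x': "x' \<in> P - Q" "x' < y" "\<forall>t. x' \<le> t \<and> t < y \<longrightarrow> 1 \<le> D t"
        using left_x 3 by auto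
      show ?thesis
      proof (rule ccontr)
        assume no: "\<not> ?thesis"
        obtain t where t: "y \<le> t" "t < x" "\<not> (cnt P t < cnt U t \<and> cnt L' t < cnt Q t)"
          using right[OF x(1,2)] no by blast
        obtain s where s: "x' \<le> s" "s < y" "\<not> (cnt L s < cnt P s \<and> cnt Q s < cnt U' s)"
          using left[OF x'(1,2)] no by blast
        \<comment> \<open>The sign of \<open>D\<close> decides which bound of \<open>Q\<close> can
          be tight: a tight bound at \<open>t\<close> needs a removed element still to come, and one
          at \<open>s\<close> needs it already passed. In each case \<open>P\<close> lies on a
          boundary path.\<close>
        have "D t < 1" "1 \<le> D s" using x(3) x'(3) s t by auto
        then have T: "t < a \<and> cnt P t = cnt U t \<or> t < b \<and> cnt P t = cnt L t"
          and S: "b \<le> s \<and> cnt P s = cnt L s \<or> a \<le> s \<and> cnt P s = cnt U s"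
          using t(3) s(3) Pb[of t] Qb[of t] u'[of t] l'[of t] Pb[of s] Qb[of s] u'[of s] l'[of s]
          unfolding D_def by (auto split: if_splits)
        have st: "s < t" "s \<le> y - 1" using s t by auto
        \<comment> \<open>The final \<open>- 1\<close> comes from \<open>y\<close>, which lies in
          \<open>s < y <= t\<close> and is an East step of \<open>P\<close>.\<close>
        have climb: "cnt P t \<le> cnt P s + (t - s) - 1"
        proof -
          have "cnt P t \<le> cnt P y + (t - y)" using t by (intro cnt_add_le) simp
          moreover have "cnt P y = cnt P (y - 1)" using cnt_step[OF yn(1), of P] y by simp
          moreover have "cnt P (y - 1) \<le> cnt P s + (y - 1 - s)" using st by (intro cnt_add_le) simp
          ultimately show ?thesis using s t by linarith
        qed
        \<comment> \<open>As \<open>s < t\<close>, the same element cannot be both passed at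
          \<open>s\<close> and still to come at \<open>t\<close>. Either
          \<open>b <= s < t < a\<close>, where \<open>P\<close> would have to climb from
          \<open>L\<close> to \<open>U\<close> too fast, or \<open>a <= s < t < b\<close>, where it
          would have to descend from \<open>U\<close> to \<open>L\<close>.\<close>
        from T S consider "t < a" "cnt P t = cnt U t" "b \<le> s" "cnt P s = cnt L s"
          | "t < b" "cnt P t = cnt L t" "a \<le> s" "cnt P s = cnt U s"
          using st by linarith
        then show False
        proof cases
          case 1
          have "cnt U a \<le> cnt U t + (a - t)" "cnt L s \<le> cnt L b + (s - b)"
            using 1 by (simp_all only: cnt_add_le less_imp_le)
          then show False using 1 good climb st by linarith
        next
          case 2
          have "cnt U a \<le> cnt U s" using 2(3) by (rule cnt_mono)
          moreover have "cnt P s \<le> cnt P t" using st(1) by (intro cnt_mono) simp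
          moreover have "cnt L t \<le> cnt L (b - 1)" using 2(1) by (intro cnt_mono) simp
          moreover have "cnt L b = cnt L (b - 1) + 1" using cnt_step[OF pos(3), of L] ab by simp
          ultimately show False using 2 good by linarith
        qed
      qed
    qed
  qed
qed

text \<open>The symmetric exchange with equal pairs of paths, where the prescribed element is the
  one leaving \<open>A\<close>; only its second half is kept.\<close>

lemma matroid_lpm:
  assumes "lpm_pair n U L"
  shows "matroid (lpm n U L)"
  unfolding matroid_def
proof (intro conjI ballI)
  show "finite (ground (lpm n U L))" by simp
  show "bases (lpm n U L) \<noteq> {}" using lpm_upper_base[OF assms] by blast
  show "B \<subseteq> ground (lpm n U L)" if "B \<in> bases (lpm n U L)" for B
    using that bases_lpm[OF assms] by simp
  fix A B x assume "A \<in> bases (lpm n U L)" "B \<in> bases (lpm n U L)" "x \<in> A - B"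
  then show "\<exists>y\<in>B - A. insert y (A - {x}) \<in> bases (lpm n U L)"
    using lpm_symmetric_exchange[OF assms assms, of B A x] by metis
qed

text \<open>An optimal pair of bases for \<open>(X, insert y X)\<close> is turned by the exchange into a pair of bases
  for \<open>(insert y X, X)\<close> without loss.\<close>

lemma rank_quotientI_exchange:
  assumes eq: "equicardinal M" and eq': "equicardinal M'" and g: "ground M' = ground M"
    and exch: "\<And>P Q y. P \<in> bases M \<Longrightarrow> Q \<in> bases M' \<Longrightarrow> y \<in> Q - P \<Longrightarrow>
      \<exists>x\<in>P - Q. insert y (P - {x}) \<in> bases M \<and> insert x (Q - {y}) \<in> bases M'"
  shows "rank_quotient M' M"
  unfolding rank_quotient_def
proof (intro conjI allI ballI impI)
  fix X y assume X: "X \<subseteq> ground M"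
  obtain P where P: "P \<in> bases M" "card (P \<inter> X) = rk M X" by (rule rk_attained[OF eq])
  obtain Q where Q: "Q \<in> bases M'" "card (Q \<inter> insert y X) = rk M' (insert y X)"
    by (rule rk_attained[OF eq'])
  have fin: "finite P" "finite Q" using finite_base[OF eq P(1)] finite_base[OF eq' Q(1)] by auto
  show "rk M' (insert y X) + rk M X \<le> rk M (insert y X) + rk M' X"
  proof (cases "y \<in> X \<or> y \<notin> Q")
    case True
    then have "Q \<inter> insert y X = Q \<inter> X" by blast
    then have "rk M' (insert y X) \<le> rk M' X" using Q card_base_Int_le_rk[OF eq' Q(1), of X] by simp
    moreover have "rk M X \<le> rk M (insert y X)" by (rule rk_mono[OF eq subset_insertI])
    ultimately show ?thesis by simp
  next
    case False
    then have y: "y \<notin> X" "y \<in> Q" by auto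
    then have Qy: "card (Q \<inter> insert y X) = Suc (card (Q \<inter> X))" using fin by simp
    show ?thesis
    proof (cases "y \<in> P")
      case True
      then have "card (P \<inter> insert y X) = Suc (card (P \<inter> X))" using fin y by simp
      then show ?thesis using P Q Qy card_base_Int_le_rk[OF eq P(1), of "insert y X"]
          card_base_Int_le_rk[OF eq' Q(1), of X] by simp
    next
      case False
      then obtain x where x: "x \<in> P - Q" and P': "insert y (P - {x}) \<in> bases M"
        and Q': "insert x (Q - {y}) \<in> bases M'"
        using exch[OF P(1) Q(1), of y] y by blast
      \<comment> \<open>If \<open>x\<close> lies in \<open>X\<close>, the exchange takes it from the
        first trace and gives it to the second, so \<open>?c\<close> cancels in the sum.\<close>
      let ?c = "if x \<in> X then 1 else 0 :: nat"
      have "x \<noteq> y" using x y by blast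
      have "insert y (P - {x}) \<inter> insert y X = insert y (P \<inter> X - {x})" using y by blast
      then have "card (insert y (P - {x}) \<inter> insert y X) + ?c = Suc (card (P \<inter> X))"
        using x y fin False card_Suc_Diff1[of "P \<inter> X" x] by auto
      moreover have "insert x (Q - {y}) \<inter> X = (if x \<in> X then insert x (Q \<inter> X) else Q \<inter> X)"
        using y by auto
      then have "card (insert x (Q - {y}) \<inter> X) = card (Q \<inter> X) + ?c" using x fin by simp
      ultimately show ?thesis
        using P Q Qy card_base_Int_le_rk[OF eq P', of "insert y X"]
          card_base_Int_le_rk[OF eq' Q', of X] by simp
    qed
  qed
qed (fact g)

lemma good_pair_rank_quotient:
  assumes UL: "lpm_pair n U L" and g: "good_pair U L b a"
  shows "rank_quotient (lpm n (U - {a}) (L - {b})) (lpm n U L)"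
proof -
  note UL' = good_pair_lpm_pair[OF assms]
  show ?thesis
    by (rule rank_quotientI_exchange[OF matroid_equicardinal[OF matroid_lpm[OF UL]]
          matroid_equicardinal[OF matroid_lpm[OF UL']] _ lpm_symmetric_exchange[OF UL UL']])
      (use g in auto)
qed

section \<open>Quotients of lattice path matroids\<close>

lemma card_Int_interval: "s \<le> t \<Longrightarrow> card (S \<inter> {Suc s..t}) + cnt S s = cnt S t"
proof -
  assume "s \<le> t"
  then have "S \<inter> {..t} = (S \<inter> {Suc s..t}) \<union> (S \<inter> {..s})" by auto
  then show ?thesis unfolding cnt_def by (simp add: card_Un_disjoint disjoint_iff)
qed

lemma card_Int_prefix: "0 \<notin> S \<Longrightarrow> card (S \<inter> {1..t}) = cnt S t"
  using card_Int_interval[of 0 t S] cnt_0[of S] by simp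

lemma cnt_Diff: "U' \<subseteq> U \<Longrightarrow> cnt U' t + cnt (U - U') t = cnt U t"
proof -
  assume "U' \<subseteq> U"
  then have "U \<inter> {..t} = (U' \<inter> {..t}) \<union> ((U - U') \<inter> {..t})" by auto
  then show ?thesis unfolding cnt_def by (simp add: card_Un_disjoint disjoint_iff)
qed

context
  fixes n :: nat and U L :: "nat set"
  assumes UL: "lpm_pair n U L"
begin

lemma lpm_pair_simps: "U \<subseteq> {1..n}" "L \<subseteq> {1..n}" "card L = card U" "finite U" "finite L"
  "0 \<notin> U" "0 \<notin> L" "cnt L t \<le> cnt U t" "n \<le> t \<Longrightarrow> cnt U t = card U" "n \<le> t \<Longrightarrow> cnt L t = card U"
proof -
  show U: "U \<subseteq> {1..n}" and L: "L \<subseteq> {1..n}" and c: "card L = card U" and "cnt L t \<le> cnt U t"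
    using UL by (simp_all add: lpm_pair_iff)
  show "finite U" "finite L"
    using finite_subset[OF U finite_atLeastAtMost] finite_subset[OF L finite_atLeastAtMost] .
  show "0 \<notin> U" "0 \<notin> L" using U L by auto
  show "n \<le> t \<Longrightarrow> cnt U t = card U" "n \<le> t \<Longrightarrow> cnt L t = card U"
    using cnt_eq_card[OF U, of t] cnt_eq_card[OF L, of t] c by simp_all
qed

lemma equicardinal_lpm: "equicardinal (lpm n U L)"
  by (rule matroid_equicardinal[OF matroid_lpm[OF UL]])

lemma lpm_base_cnt:
  assumes "B \<in> bases (lpm n U L)"
  shows "0 \<notin> B" "B \<subseteq> {1..n}" "cnt L t \<le> cnt B t" "cnt B t \<le> cnt U t" "cnt B n = card U"
proof -
  show B: "B \<subseteq> {1..n}" "cnt L t \<le> cnt B t" "cnt B t \<le> cnt U t" for t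
    using assms by (simp_all add: bases_lpm[OF UL])
  show "0 \<notin> B" using B(1) by auto
  show "cnt B n = card U" using B(2,3)[of n] lpm_pair_simps(9,10)[of n] by simp
qed

text \<open>The upper path takes its North steps as early as possible and so attains the rank of
  every initial interval.\<close>

lemma rk_lpm_prefix: "rk (lpm n U L) {1..t} = cnt U t"
proof (rule antisym)
  show "rk (lpm n U L) {1..t} \<le> cnt U t"
    by (rule rk_leI[OF equicardinal_lpm])
      (simp only: card_Int_prefix[OF lpm_base_cnt(1)] lpm_base_cnt(4))
  show "cnt U t \<le> rk (lpm n U L) {1..t}"
    using card_base_Int_le_rk[OF equicardinal_lpm lpm_upper_base[OF UL], of "{1..t}"]
    by (simp only: card_Int_prefix[OF lpm_pair_simps(6)])
qed

text \<open>The lower path delays its North steps and so attains the rank of every final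
  interval.\<close>

lemma rk_lpm_suffix:
  assumes t: "t \<le> n" shows "rk (lpm n U L) {Suc t..n} + cnt L t = card U"
proof (rule antisym)
  obtain B where B: "B \<in> bases (lpm n U L)" "card (B \<inter> {Suc t..n}) = rk (lpm n U L) {Suc t..n}"
    by (rule rk_attained[OF equicardinal_lpm])
  show "rk (lpm n U L) {Suc t..n} + cnt L t \<le> card U"
    using B(2) card_Int_interval[OF t, of B] lpm_base_cnt(3)[OF B(1), of t] lpm_base_cnt(5)[OF B(1)]
    by simp
  show "card U \<le> rk (lpm n U L) {Suc t..n} + cnt L t"
    using card_base_Int_le_rk[OF equicardinal_lpm lpm_lower_base[OF UL], of "{Suc t..n}"]
      card_Int_interval[OF t, of L] lpm_pair_simps(10)[of n] by simp
qed

lemma rk_lpm_ground: "rk (lpm n U L) {1..n} = card U"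
  using rk_lpm_prefix[of n] lpm_pair_simps(9)[of n] by simp

text \<open>Allows bases to be prescribed by a formula for their height, as needed for the extremal
  paths that witness a bad pair.\<close>

lemma lpm_base_of_cnt:
  assumes f0: "f 0 = 0" and step: "\<And>t. f t \<le> f (Suc t)" "\<And>t. f (Suc t) \<le> Suc (f t)"
    and bd: "\<And>t. cnt L t \<le> f t" "\<And>t. f t \<le> cnt U t"
  shows "\<exists>B\<in>bases (lpm n U L). \<forall>t. cnt B t = f t"
proof -
  define B where "B = {t. 0 < t \<and> f t = Suc (f (t - 1))}"
  have c: "cnt B t = f t" for t
  proof (induction t)
    case 0
    then show ?case using f0 cnt_0[of B] by (simp add: B_def)
  next
    case (Suc t)
    have "Suc t \<in> B \<longleftrightarrow> f (Suc t) = Suc (f t)" by (simp add: B_def)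
    then show ?case using Suc.IH step(1)[of t] step(2)[of t] cnt_Suc[of B t] by auto
  qed
  \<comment> \<open>Beyond \<open>n\<close> both bounds equal the rank, so \<open>f\<close> is
    constant there.\<close>
  have "t \<le> n" if "t \<in> B" for t
  proof (rule ccontr)
    assume "\<not> t \<le> n"
    then have "f t = card U" "f (t - 1) = card U"
      using bd(1)[of t] bd(2)[of t] bd(1)[of "t - 1"] bd(2)[of "t - 1"]
        lpm_pair_simps(9,10)[of t] lpm_pair_simps(9,10)[of "t - 1"] by auto
    then show False using that by (simp add: B_def)
  qed
  moreover have "0 < t" if "t \<in> B" for t using that by (simp add: B_def)
  ultimately have "B \<subseteq> {1..n}" by (auto simp: Suc_le_eq)
  then have "B \<in> bases (lpm n U L)" using bd by (simp add: bases_lpm[OF UL] c)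
  then show ?thesis using c by blast
qed

end

text \<open>The greedy pairing matches \<open>a\<close> and \<open>b\<close> iff they have the same position in \<open>U - U'\<close> and \<open>L - L'\<close>.
  Removing the previous pairs lowers both indices by the same amount, so goodness can be
  tested in \<open>(U, L)\<close>.\<close>

definition all_good :: "nat set \<Rightarrow> nat set \<Rightarrow> nat set \<Rightarrow> nat set \<Rightarrow> bool" where
  "all_good U' L' U L \<longleftrightarrow> U' \<subseteq> U \<and> L' \<subseteq> L \<and>
     (\<forall>a\<in>U - U'. \<forall>b\<in>L - L'. cnt (U - U') a = cnt (L - L') b \<longrightarrow> good_pair U L b a)"

context
  fixes n :: nat and U L U' L' :: "nat set"
  assumes UL: "lpm_pair n U L" and UL': "lpm_pair n U' L'"
begin

text \<open>Adding \<open>a\<close> to \<open>{1..a - 1}\<close>, or \<open>b\<close> to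
  \<open>{Suc b..n}\<close>, raises the rank exactly when the element belongs to the upper,
  respectively lower, path.\<close>

lemma rank_quotient_lpm_subset:
  assumes q: "rank_quotient (lpm n U' L') (lpm n U L)"
  shows "U' \<subseteq> U" "L' \<subseteq> L"
proof -
  let ?M = "lpm n U L" and ?M' = "lpm n U' L'"
  have qq: "rk ?M' (insert y X) + rk ?M X \<le> rk ?M (insert y X) + rk ?M' X"
    if "y \<in> {1..n}" "X \<subseteq> {1..n}" for X y
    using q that unfolding rank_quotient_def by simp
  show "U' \<subseteq> U"
  proof
    fix a assume a: "a \<in> U'"
    then have an: "1 \<le> a" "a \<le> n" using lpm_pair_simps(1)[OF UL'] by auto
    then have "insert a {1..a - 1} = {1..a}" by auto
    moreover have "a \<in> {1..n}" "{1..a - 1} \<subseteq> {1..n}" using an by auto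
    ultimately have "rk ?M' {1..a} + rk ?M {1..a - 1} \<le> rk ?M {1..a} + rk ?M' {1..a - 1}"
      using qq[of a "{1..a - 1}"] by metis
    then have "cnt U' a + cnt U (a - 1) \<le> cnt U a + cnt U' (a - 1)"
      by (simp only: rk_lpm_prefix[OF UL] rk_lpm_prefix[OF UL'])
    then show "a \<in> U" using cnt_step[of a U] cnt_step[of a U'] an a by (auto split: if_splits)
  qed
  show "L' \<subseteq> L"
  proof
    fix b assume b: "b \<in> L'"
    then have bn: "1 \<le> b" "b \<le> n" using lpm_pair_simps(2)[OF UL'] by auto
    then have "insert b {Suc b..n} = {Suc (b - 1)..n}" by auto
    moreover have "b \<in> {1..n}" "{Suc b..n} \<subseteq> {1..n}" using bn by auto
    ultimately have "rk ?M' {Suc (b - 1)..n} + rk ?M {Suc b..n} \<le>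
        rk ?M {Suc (b - 1)..n} + rk ?M' {Suc b..n}"
      using qq[of b "{Suc b..n}"] by metis
    moreover have "b - 1 \<le> n" using bn by simp
    ultimately have "cnt L' b + cnt L (b - 1) \<le> cnt L b + cnt L' (b - 1)"
      using rk_lpm_suffix[OF UL bn(2)] rk_lpm_suffix[OF UL' bn(2)]
        rk_lpm_suffix[OF UL, of "b - 1"] rk_lpm_suffix[OF UL', of "b - 1"] by linarith
    then show "b \<in> L" using cnt_step[of b L] cnt_step[of b L'] bn b by (auto split: if_splits)
  qed
qed

text \<open>If the step \<open>a\<close> of \<open>U\<close> is lower than the step \<open>b\<close>
  of \<open>L\<close>, then \<open>a < b\<close>, and \<open>{1..a}\<close> joined with
  \<open>{b..n}\<close> is tested against the ground set. If it is further right, then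
  \<open>b < a\<close>, and the interval strictly between them is tested against the empty
  set.\<close>

lemma rank_quotient_lpm_all_good:
  assumes q: "rank_quotient (lpm n U' L') (lpm n U L)"
  shows "all_good U' L' U L"
proof -
  note sub = rank_quotient_lpm_subset[OF q]
  let ?M = "lpm n U L" and ?M' = "lpm n U' L'"
  have mono: "rk ?M' Y + rk ?M X \<le> rk ?M Y + rk ?M' X" if "X \<subseteq> Y" "Y \<subseteq> {1..n}" for X Y
    using rank_quotient_mono[OF matroid_lpm[OF UL] q that(1)] that(2) by simp
  have "good_pair U L b a"
    if a: "a \<in> U" "a \<notin> U'" and b: "b \<in> L" "b \<notin> L'" and eq: "cnt (U - U') a = cnt (L - L') b"
    for a b
  proof -
    have pos: "0 < a" "a \<le> n" "0 < b" "b \<le> n"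
      using a(1) b(1) lpm_pair_simps(1,2)[OF UL] by auto
    have u: "cnt U' t + cnt (U - U') t = cnt U t" and l: "cnt L' t + cnt (L - L') t = cnt L t" for t
      using sub by (simp_all add: cnt_Diff)
    have lb: "cnt L b = Suc (cnt L (b - 1))" "cnt L' b = cnt L' (b - 1)"
      using cnt_step[OF pos(3)] b by simp_all
    have ua: "cnt U a = Suc (cnt U (a - 1))" "cnt U' a = cnt U' (a - 1)"
      using cnt_step[OF pos(1)] a by simp_all
    have "cnt L b \<le> cnt U a"
    proof (rule ccontr)
      assume "\<not> ?thesis"
      then have lt: "cnt U a < cnt L b" by simp
      have ab: "a < b"
      proof (rule ccontr)
        assume "\<not> a < b"
        then have "cnt U b \<le> cnt U a" by (intro cnt_mono) simp
        then show False using lt lpm_pair_simps(8)[OF UL, of b] by simp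
      qed
      \<comment> \<open>Follow \<open>U\<close> up to height \<open>cnt U a\<close>, go East until
        \<open>L\<close> is met, then follow \<open>L\<close>. This base attains the ranks of
        \<open>{1..a}\<close> and \<open>{b..n}\<close> simultaneously.\<close>
      define f where "f t = max (min (cnt U t) (cnt U a)) (cnt L t)" for t
      have "\<exists>B\<in>bases ?M. \<forall>t. cnt B t = f t"
      proof (rule lpm_base_of_cnt[OF UL, of f])
        show "f 0 = 0" using cnt_0 lpm_pair_simps(6,7)[OF UL] by (simp add: f_def)
        show "f t \<le> f (Suc t)" "f (Suc t) \<le> Suc (f t)" for t
          unfolding f_def using cnt_Suc[of U t] cnt_Suc[of L t] by (auto split: if_splits)
        show "cnt L t \<le> f t" "f t \<le> cnt U t" for t
          unfolding f_def using lpm_pair_simps(8)[OF UL, of t] by auto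
      qed
      then obtain B where B: "B \<in> bases ?M" "\<And>t. cnt B t = f t" by blast
      have fa: "f a = cnt U a" unfolding f_def using lpm_pair_simps(8)[OF UL, of a] by simp
      have fb: "f (b - 1) = cnt L (b - 1)" unfolding f_def using lt lb by simp
      define X where "X = {1..a} \<union> {Suc (b - 1)..n}"
      have "card (B \<inter> X) = card (B \<inter> {1..a}) + card (B \<inter> {Suc (b - 1)..n})"
        unfolding X_def Int_Un_distrib using ab by (subst card_Un_disjoint) auto
      moreover have "card (B \<inter> {1..a}) = cnt U a"
        using card_Int_prefix[OF lpm_base_cnt(1)[OF UL B(1)], of a] B(2) fa by simp
      moreover have "card (B \<inter> {Suc (b - 1)..n}) + cnt L (b - 1) = card U"
        using card_Int_interval[of "b - 1" n B] lpm_base_cnt(5)[OF UL B(1)] B(2) fb pos by simp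
      moreover have "card (B \<inter> X) \<le> rk ?M X"
        by (rule card_base_Int_le_rk[OF equicardinal_lpm[OF UL] B(1)])
      moreover have "rk ?M' X \<le> rk ?M' {1..a} + rk ?M' {Suc (b - 1)..n}"
        unfolding X_def by (rule rk_Un_le[OF equicardinal_lpm[OF UL']])
      moreover have "rk ?M' {1..a} = cnt U' a" by (rule rk_lpm_prefix[OF UL'])
      moreover have "rk ?M' {Suc (b - 1)..n} + cnt L' (b - 1) = card U'"
        using pos by (intro rk_lpm_suffix[OF UL']) simp
      moreover have "rk ?M' {1..n} + rk ?M X \<le> rk ?M {1..n} + rk ?M' X"
        using pos by (intro mono) (auto simp: X_def)
      moreover have "rk ?M' {1..n} = card U'" "rk ?M {1..n} = card U"
        by (rule rk_lpm_ground[OF UL'], rule rk_lpm_ground[OF UL])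
      ultimately show False using u[of a] l[of b] lb eq by linarith
    qed
    moreover have "a + cnt L b \<le> b + cnt U a"
    proof (rule ccontr)
      assume "\<not> ?thesis"
      then have lt: "b + cnt U a < a + cnt L b" by simp
      have ab: "b < a"
      proof (rule ccontr)
        assume "\<not> b < a"
        then have "cnt U b \<le> cnt U a + (b - a)" by (intro cnt_add_le) simp
        then show False using lt lpm_pair_simps(8)[OF UL, of b] \<open>\<not> b < a\<close> by simp
      qed
      have lb': "cnt L' b \<le> b" by (rule cnt_le_self[OF lpm_pair_simps(2)[OF UL']])
      \<comment> \<open>Follow \<open>L'\<close> up to \<open>b\<close>, then take only North steps
        until \<open>U'\<close> is met, and follow \<open>U'\<close>. The line of slope one through
        the point of \<open>L'\<close> at \<open>b\<close> is \<open>t - (b - cnt L' b)\<close>,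
        truncated at 0.\<close>
      define f where "f t = min (cnt U' t) (max (cnt L' t) (t - (b - cnt L' b)))" for t
      have "\<exists>B\<in>bases ?M'. \<forall>t. cnt B t = f t"
      proof (rule lpm_base_of_cnt[OF UL', of f])
        show "f 0 = 0" using cnt_0 lpm_pair_simps(6,7)[OF UL'] by (simp add: f_def)
        show "f t \<le> f (Suc t)" "f (Suc t) \<le> Suc (f t)" for t
        proof -
          have "cnt U' t \<le> cnt U' (Suc t) \<and> cnt U' (Suc t) \<le> Suc (cnt U' t)"
            "cnt L' t \<le> cnt L' (Suc t) \<and> cnt L' (Suc t) \<le> Suc (cnt L' t)"
            by (simp_all add: cnt_Suc)
          then show "f t \<le> f (Suc t)" "f (Suc t) \<le> Suc (f t)"
            unfolding f_def by linarith+
        qed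
        show "cnt L' t \<le> f t" "f t \<le> cnt U' t" for t
          unfolding f_def using lpm_pair_simps(8)[OF UL', of t] by auto
      qed
      then obtain B where B: "B \<in> bases ?M'" "\<And>t. cnt B t = f t" by blast
      have fb: "f b = cnt L' b" unfolding f_def using lpm_pair_simps(8)[OF UL', of b] lb' by simp
      \<comment> \<open>Equal positions of \<open>a\<close> and \<open>b\<close> among the removed
        elements transfer the failed inequality to \<open>U'\<close> and \<open>L'\<close>: the line
        has reached \<open>U'\<close> by \<open>a - 1\<close>, so this base of the smaller matroid
        has one element more in \<open>X\<close> than \<open>?M\<close> allows.\<close>
      have "cnt U' (a - 1) \<le> (a - 1) - (b - cnt L' b)"
        using lt u[of a] l[of b] ua eq lb' ab by simp
      then have fa: "f (a - 1) = cnt U' (a - 1)" unfolding f_def by simp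
      have ba: "b \<le> a - 1" using ab by simp
      define X where "X = {Suc b..a - 1}"
      have "card (B \<inter> X) + cnt L' b = cnt U' (a - 1)"
        unfolding X_def using card_Int_interval[OF ba, of B] B(2) fa fb by simp
      moreover have "card (B \<inter> X) \<le> rk ?M' X"
        by (rule card_base_Int_le_rk[OF equicardinal_lpm[OF UL'] B(1)])
      moreover have "X \<subseteq> {1..n}" using pos by (auto simp: X_def)
      then have "rk ?M' X \<le> rk ?M X"
        using mono[of "{}" X] rk_empty[OF equicardinal_lpm[OF UL]]
          rk_empty[OF equicardinal_lpm[OF UL']] by simp
      moreover have "rk ?M X + cnt L b \<le> cnt U (a - 1)"
      proof -
        obtain C where C: "C \<in> bases ?M" "card (C \<inter> X) = rk ?M X"
          by (rule rk_attained[OF equicardinal_lpm[OF UL]])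
        then show ?thesis
          using card_Int_interval[OF ba, of C] lpm_base_cnt(3)[OF UL C(1), of b]
            lpm_base_cnt(4)[OF UL C(1), of "a - 1"] unfolding X_def by simp
      qed
      ultimately show False using u[of a] l[of b] ua eq by linarith
    qed
    ultimately show ?thesis using a(1) b(1) by (simp add: good_pair_def)
  qed
  then show ?thesis using sub unfolding all_good_def by blast
qed

text \<open>The induction step for everything that follows. The last two conclusions make
  \<open>(b, a)\<close> an upper bound for all labels further down.\<close>

lemma all_good_remove_Max:
  assumes g: "all_good U' L' U L" and ne: "U' \<noteq> U"
  obtains a b where "a \<in> U - U'" "b \<in> L - L'" "good_pair U L b a"
    "lpm_pair n (U - {a}) (L - {b})" "all_good U' L' (U - {a}) (L - {b})"
    "\<And>x. x \<in> U - {a} - U' \<Longrightarrow> x \<le> a" "\<And>x. x \<in> L - {b} - L' \<Longrightarrow> x \<le> b"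
proof -
  have sub: "U' \<subseteq> U" "L' \<subseteq> L" using g by (simp_all add: all_good_def)
  have fin: "finite (U - U')" "finite (L - L')" using lpm_pair_simps(4,5)[OF UL] by simp_all
  have card: "card (U - U') = card (L - L')"
    using sub lpm_pair_simps(3,4,5)[OF UL] lpm_pair_simps(3,4,5)[OF UL']
    by (simp add: card_Diff_subset)
  have neU: "U - U' \<noteq> {}" using sub ne by blast
  then have neL: "L - L' \<noteq> {}" using card fin by (metis card_0_eq card.empty)
  define a b where "a = Max (U - U')" and "b = Max (L - L')"
  have a: "a \<in> U - U'" and b: "b \<in> L - L'"
    unfolding a_def b_def
    by (rule Max_in[OF fin(1) neU], rule Max_in[OF fin(2) neL])
  have amax: "x \<le> a" if "x \<in> U - U'" for x unfolding a_def using fin that by (intro Max_ge)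
  have bmax: "x \<le> b" if "x \<in> L - L'" for x unfolding b_def using fin that by (intro Max_ge)
  have "(U - U') \<inter> {..a} = U - U'" "(L - L') \<inter> {..b} = L - L'" using amax bmax by auto
  \<comment> \<open>The maxima hold the last positions, which agree because the two differences have
    equal size.\<close>
  then have "cnt (U - U') a = cnt (L - L') b" using card by (simp add: cnt_def)
  then have gp: "good_pair U L b a" using g a b by (simp add: all_good_def)
  have "good_pair (U - {a}) (L - {b}) d c"
    if c: "c \<in> U - {a} - U'" and d: "d \<in> L - {b} - L'"
      and eq: "cnt (U - {a} - U') c = cnt (L - {b} - L') d" for c d
  proof -
    have lt: "c < a" "d < b" using amax[of c] bmax[of d] c d by auto
    have "U - {a} - U' = (U - U') - {a}" "L - {b} - L' = (L - L') - {b}" by auto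
    then have "cnt (U - U') c = cnt (L - L') d"
      using eq cnt_remove[OF a, of c] cnt_remove[OF b, of d] lt by simp
    then have "good_pair U L d c" using g c d by (simp add: all_good_def)
    moreover have "cnt (U - {a}) c = cnt U c" "cnt (L - {b}) d = cnt L d"
      using cnt_remove[of a U c] cnt_remove[of b L d] a b lt by simp_all
    ultimately show ?thesis using lt by (simp add: good_pair_def)
  qed
  then have "all_good U' L' (U - {a}) (L - {b})"
    using sub a b unfolding all_good_def by blast
  then show ?thesis
    using a b gp good_pair_lpm_pair[OF UL gp] amax bmax by (intro that) auto
qed

end

lemma all_good_rank_quotient:
  assumes "lpm_pair n U L" "lpm_pair n U' L'" "all_good U' L' U L"
  shows "rank_quotient (lpm n U' L') (lpm n U L)"
  using assms(1,3)
proof (induction "card (U - U')" arbitrary: U L rule: less_induct)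
  case less
  note UL = less.prems(1) and g = less.prems(2)
  show ?case
  proof (cases "U' = U")
    case True
    then have "card L' = card L"
      using lpm_pair_simps(3)[OF UL] lpm_pair_simps(3)[OF assms(2)] by simp
    then have "L' = L" using g lpm_pair_simps(5)[OF UL] by (simp add: all_good_def card_subset_eq)
    then show ?thesis using True rank_quotient_refl by simp
  next
    case False
    obtain a b where a: "a \<in> U - U'" and gp: "good_pair U L b a"
      and UL1: "lpm_pair n (U - {a}) (L - {b})" and g1: "all_good U' L' (U - {a}) (L - {b})"
      by (rule all_good_remove_Max[OF UL assms(2) g False])
    have "U - {a} - U' \<subset> U - U'" using a by blast
    then have "card (U - {a} - U') < card (U - U')"
      using lpm_pair_simps(4)[OF UL] by (intro psubset_card_mono) auto
    then have "rank_quotient (lpm n U' L') (lpm n (U - {a}) (L - {b}))"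
      using less.hyps UL1 g1 by blast
    then show ?thesis using good_pair_rank_quotient[OF UL gp] by (rule rank_quotient_trans)
  qed
qed

lemma lpm_quotient_iff:
  assumes UL: "lpm_pair n U L" and UL': "lpm_pair n U' L'"
  shows "matroid_quotient (lpm n U' L') (lpm n U L) \<longleftrightarrow> all_good U' L' U L"
proof
  show "matroid_quotient (lpm n U' L') (lpm n U L) \<Longrightarrow> all_good U' L' U L"
    by (intro rank_quotient_lpm_all_good[OF UL UL'] matroid_quotient_imp_rank_quotient)
  show "all_good U' L' U L \<Longrightarrow> matroid_quotient (lpm n U' L') (lpm n U L)"
    by (intro rank_quotient_imp_matroid_quotient matroid_lpm[OF UL] matroid_lpm[OF UL']
        all_good_rank_quotient[OF UL UL'] infinite_UNIV_nat)
qed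

section \<open>Maximal chains and their labels\<close>

text \<open>Steps raise the rank by one instead of being covers, so the recursion along the list
  involves no quantifier over the poset.\<close>

definition saturated_chain ::
  "'a set \<Rightarrow> ('a \<Rightarrow> 'a \<Rightarrow> bool) \<Rightarrow> ('a \<Rightarrow> nat) \<Rightarrow> 'a \<Rightarrow> 'a \<Rightarrow> 'a list \<Rightarrow> bool" where
  "saturated_chain P le \<rho> x y C \<longleftrightarrow> C \<noteq> [] \<and> hd C = x \<and> last C = y \<and> set C \<subseteq> P \<and>
     successively (\<lambda>a b. le a b \<and> \<rho> b = Suc (\<rho> a)) C"

lemma saturated_chain_simps:
  "saturated_chain P le \<rho> x y [c] \<longleftrightarrow> c = x \<and> c = y \<and> c \<in> P"
  "saturated_chain P le \<rho> x y (c # d # C) \<longleftrightarrow>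
     c = x \<and> x \<in> P \<and> le c d \<and> \<rho> d = Suc (\<rho> c) \<and> saturated_chain P le \<rho> d y (d # C)"
  by (auto simp: saturated_chain_def)

lemma saturated_chain_Nil: "\<not> saturated_chain P le \<rho> x y []"
  by (simp add: saturated_chain_def)

lemma saturated_chain_snoc:
  "saturated_chain P le \<rho> x y C \<Longrightarrow> z \<in> P \<Longrightarrow> le y z \<Longrightarrow> \<rho> z = Suc (\<rho> y) \<Longrightarrow>
   saturated_chain P le \<rho> x z (C @ [z])"
  by (auto simp: saturated_chain_def successively_append_iff)

text \<open>\<open>between\<close> asks only for some element of intermediate rank, yet this already
  forces covers to raise the rank by exactly one. Antisymmetry follows from
  \<open>rank_less\<close>.\<close>

locale graded_poset =
  fixes P :: "'a set" and le :: "'a \<Rightarrow> 'a \<Rightarrow> bool" and \<rho> :: "'a \<Rightarrow> nat"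
  assumes le_refl: "x \<in> P \<Longrightarrow> le x x"
    and le_trans: "x \<in> P \<Longrightarrow> y \<in> P \<Longrightarrow> z \<in> P \<Longrightarrow> le x y \<Longrightarrow> le y z \<Longrightarrow> le x z"
    and rank_less: "x \<in> P \<Longrightarrow> y \<in> P \<Longrightarrow> le x y \<Longrightarrow> x \<noteq> y \<Longrightarrow> \<rho> x < \<rho> y"
    and between: "x \<in> P \<Longrightarrow> y \<in> P \<Longrightarrow> le x y \<Longrightarrow> Suc (\<rho> x) < \<rho> y \<Longrightarrow>
      \<exists>z\<in>P. le x z \<and> le z y \<and> \<rho> x < \<rho> z \<and> \<rho> z < \<rho> y"
begin

lemma strictI: "le x y \<Longrightarrow> \<rho> x < \<rho> y \<Longrightarrow> strict le x y"
  by (auto simp: strict_def)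

lemma rank_le: "x \<in> P \<Longrightarrow> y \<in> P \<Longrightarrow> le x y \<Longrightarrow> \<rho> x \<le> \<rho> y"
  using rank_less by (cases "x = y") (auto intro: less_imp_le)

lemma le_antisym: "x \<in> P \<Longrightarrow> y \<in> P \<Longrightarrow> le x y \<Longrightarrow> le y x \<Longrightarrow> x = y"
  using rank_less[of x y] rank_less[of y x] by (cases "x = y") simp_all

lemma covers_rank: "covers P le x y \<Longrightarrow> x \<in> P \<and> y \<in> P \<and> le x y \<and> \<rho> y = Suc (\<rho> x)"
proof -
  assume c: "covers P le x y"
  then have xy: "x \<in> P" "y \<in> P" "le x y" "x \<noteq> y" by (auto simp: covers_def strict_def)
  have "\<not> Suc (\<rho> x) < \<rho> y"
  proof
    assume "Suc (\<rho> x) < \<rho> y"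
    then obtain z where "z \<in> P" "le x z" "le z y" "\<rho> x < \<rho> z" "\<rho> z < \<rho> y"
      using between[OF xy(1-3)] by blast
    then show False using c strictI unfolding covers_def by blast
  qed
  then show ?thesis using xy rank_less[OF xy] by simp
qed

lemma saturated_chain_props:
  "saturated_chain P le \<rho> x y C \<Longrightarrow>
     sorted_wrt (strict le) C \<and> x \<in> set C \<and> y \<in> set C \<and>
     (\<forall>c\<in>set C. c \<in> P \<and> le x c \<and> le c y \<and> \<rho> c \<le> \<rho> y) \<and>
     (\<forall>r. \<rho> x \<le> r \<and> r \<le> \<rho> y \<longrightarrow> (\<exists>c\<in>set C. \<rho> c = r))"
proof (induction C arbitrary: x rule: induct_list012)
  case 1
  then show ?case by (simp add: saturated_chain_Nil)
next
  case (2 c)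
  then have c: "c = x" "y = x" "x \<in> P" by (auto simp: saturated_chain_simps)
  then show ?case using le_refl[OF c(3)] unfolding c(1,2) by simp
next
  case (3 c d C)
  have c: "c = x" "x \<in> P" "le x d" "\<rho> d = Suc (\<rho> x)" and
    sat: "saturated_chain P le \<rho> d y (d # C)"
    using "3.prems" by (auto simp: saturated_chain_simps)
  note IH = "3.IH"(2)[OF sat]
  have d: "d \<in> P" "y \<in> P" "le d y" using IH by auto
  have xc: "le x e" "\<rho> x < \<rho> e" if e: "e \<in> set (d # C)" for e
  proof -
    have "e \<in> P" "le d e" using IH e by auto
    then show "le x e" "\<rho> x < \<rho> e"
      using le_trans[OF c(2) d(1) _ c(3)] rank_le[OF d(1)] c(4) by (auto simp: Suc_le_eq)
  qed
  have "sorted_wrt (strict le) (c # d # C)"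
    using IH xc c(1) strictI by (auto simp: sorted_wrt.simps(2)[of _ c])
  moreover have "\<forall>r. \<rho> x \<le> r \<and> r \<le> \<rho> y \<longrightarrow> (\<exists>c\<in>set (c # d # C). \<rho> c = r)"
  proof (intro allI impI)
    fix r assume r: "\<rho> x \<le> r \<and> r \<le> \<rho> y"
    show "\<exists>c\<in>set (c # d # C). \<rho> c = r"
    proof (cases "r = \<rho> x")
      case False
      then have "\<rho> d \<le> r \<and> r \<le> \<rho> y" using r c(4) by simp
      then have "\<exists>c\<in>set (d # C). \<rho> c = r" using IH by blast
      then show ?thesis by auto
    qed (use c in simp)
  qed
  moreover have "le x y" by (rule le_trans[OF c(2) d(1,2) c(3) d(3)])
  then have "\<forall>e\<in>set (c # d # C). e \<in> P \<and> le x e \<and> le e y \<and> \<rho> e \<le> \<rho> y"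
    using IH xc c le_refl rank_le[OF c(2) d(2)] by auto
  ultimately show ?case using IH c(1) by simp
qed

lemma saturated_imp_maximal_chain:
  assumes sat: "saturated_chain P le \<rho> x y C"
  shows "maximal_chain P le x y C"
proof -
  note props = saturated_chain_props[OF sat]
  have xy: "x \<in> P" "y \<in> P" using props by auto
  have sorted: "sorted_wrt (strict le) C" using props by simp
  have chain: "pred_on.chain (interval P le x y) (strict le) (set C)"
    unfolding pred_on.chain_def
  proof (intro conjI ballI)
    show "set C \<subseteq> interval P le x y" using props by (auto simp: interval_def)
    fix a b assume "a \<in> set C" "b \<in> set C"
    then obtain i j where "i < length C" "a = C ! i" "j < length C" "b = C ! j"
      by (metis in_set_conv_nth)
    then show "sup (strict le) (=) a b \<or> sup (strict le) (=) b a"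
      using sorted_wrt_nth_less[OF sorted, of i j] sorted_wrt_nth_less[OF sorted, of j i]
      by (cases i j rule: linorder_cases) auto
  qed
  have "\<not> set C \<subset> S" if S: "pred_on.chain (interval P le x y) (strict le) S" for S
  proof
    assume sub: "set C \<subset> S"
    then obtain w where w: "w \<in> S" "w \<notin> set C" by blast
    have SP: "S \<subseteq> interval P le x y" using S by (simp add: pred_on.chain_def)
    then have wP: "w \<in> P" "le x w" "le w y" using w by (auto simp: interval_def)
    \<comment> \<open>A saturated chain attains every intermediate rank. An additional
      \<open>w\<close> would be comparable to a distinct element of its own rank, which
      \<open>rank_less\<close> excludes.\<close>
    then obtain c where c: "c \<in> set C" "\<rho> c = \<rho> w"
      using props rank_le[of x w] rank_le[of w y] xy by blast
    then have "c = w \<or> strict le c w \<or> strict le w c"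
      using S sub w(1) unfolding pred_on.chain_def by blast
    moreover have "c \<in> P" using c props by blast
    ultimately show False
      using w(2) c rank_less[of c w] rank_less[of w c] wP(1) unfolding strict_def by auto
  qed
  then show ?thesis
    using sorted chain unfolding maximal_chain_def pred_on.maxchain_def by blast
qed

text \<open>An element of the interval comparable to the whole chain must belong to it. This puts
  \<open>x\<close> and \<open>y\<close> at the ends and excludes a jump in rank, where
  \<open>between\<close> would supply a new such element.\<close>

lemma maximal_imp_saturated_chain:
  assumes xy: "x \<in> P" "y \<in> P" "le x y" and max: "maximal_chain P le x y C"
  shows "saturated_chain P le \<rho> x y C"
proof -
  have sorted: "sorted_wrt (strict le) C"
    and chain: "pred_on.chain (interval P le x y) (strict le) (set C)"
    and maxi: "\<And>S. pred_on.chain (interval P le x y) (strict le) S \<Longrightarrow> \<not> set C \<subset> S"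
    using max unfolding maximal_chain_def pred_on.maxchain_def by blast+
  have CP: "c \<in> P" "le x c" "le c y" if "c \<in> set C" for c
    using chain that unfolding pred_on.chain_def interval_def by auto
  have add: "z \<in> set C"
    if z: "z \<in> P" "le x z" "le z y" and comp: "\<And>c. c \<in> set C \<Longrightarrow> le z c \<or> le c z" for z
  proof (rule ccontr)
    assume nz: "z \<notin> set C"
    have "strict le z c \<or> strict le c z" if "c \<in> set C" for c
      using comp[OF that] nz that unfolding strict_def by auto
    then have "pred_on.chain (interval P le x y) (strict le) (insert z (set C))"
      using chain z unfolding pred_on.chain_def interval_def by auto
    then show False using maxi nz by blast
  qed
  have xC: "x \<in> set C" and yC: "y \<in> set C"
    using add[OF xy(1) le_refl[OF xy(1)] xy(3)] add[OF xy(2,3) le_refl[OF xy(2)]] CP by auto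
  have nth: "strict le (C ! i) (C ! j)" if "i < j" "j < length C" for i j
    using sorted_wrt_nth_less[OF sorted that] .
  have nthP: "C ! i \<in> P" "le x (C ! i)" "le (C ! i) y" if "i < length C" for i
    using CP[of "C ! i"] that by auto
  have nth_le: "le (C ! i) (C ! j)" if "i \<le> j" "j < length C" for i j
    using nth[of i j] that le_refl nthP(1)[of j] by (cases "i = j") (auto simp: strict_def)
  have ne: "C \<noteq> []" using xC by auto
  have "hd C = x"
  proof -
    obtain i where i: "i < length C" "C ! i = x" using xC by (metis in_set_conv_nth)
    then have "le (C ! 0) x" "le x (C ! 0)" "C ! 0 \<in> P"
      using nth_le[of 0 i] nthP[of 0] ne by auto
    then have "C ! 0 = x" using le_antisym xy(1) by simp
    then show ?thesis using ne by (simp add: hd_conv_nth)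
  qed
  moreover have "last C = y"
  proof -
    let ?k = "length C - 1"
    obtain i where i: "i < length C" "C ! i = y" using yC by (metis in_set_conv_nth)
    then have "le y (C ! ?k)" "le (C ! ?k) y" "C ! ?k \<in> P"
      using nth_le[of i ?k] nthP[of ?k] ne by auto
    then have "C ! ?k = y" using le_antisym xy(2) by simp
    then show ?thesis using ne by (simp add: last_conv_nth)
  qed
  moreover have "le (C ! i) (C ! Suc i) \<and> \<rho> (C ! Suc i) = Suc (\<rho> (C ! i))"
    if i: "Suc i < length C" for i
  proof -
    let ?a = "C ! i" and ?b = "C ! Suc i"
    have ab: "?a \<in> P" "?b \<in> P" "le ?a ?b" "?a \<noteq> ?b"
      using nthP[of i] nthP[of "Suc i"] nth[of i "Suc i"] i by (auto simp: strict_def)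
    have "\<not> Suc (\<rho> ?a) < \<rho> ?b"
    proof
      assume "Suc (\<rho> ?a) < \<rho> ?b"
      then obtain z where z: "z \<in> P" "le ?a z" "le z ?b" "\<rho> ?a < \<rho> z" "\<rho> z < \<rho> ?b"
        using between[OF ab(1-3)] by blast
      have low: "le (C ! j) z \<and> \<rho> (C ! j) < \<rho> z" if "j \<le> i" for j
        using nth_le[of j i] le_trans[of "C ! j" ?a z] rank_le[of "C ! j" ?a] nthP(1)[of j] ab z i that
        by auto
      have high: "le z (C ! j) \<and> \<rho> z < \<rho> (C ! j)" if "Suc i \<le> j" "j < length C" for j
        using nth_le[of "Suc i" j] le_trans[of z ?b "C ! j"] rank_le[of ?b "C ! j"] nthP(1)[of j] ab z
          that by auto
      have lh: "j \<le> i \<or> Suc i \<le> j" for j by auto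
      have "le z c \<or> le c z" if "c \<in> set C" for c
        using that low high lh by (metis in_set_conv_nth)
      moreover have "le x z" "le z y"
        using le_trans[of x ?a z] le_trans[of z ?b y] nthP[of i] nthP[of "Suc i"] xy z ab i by auto
      ultimately have "z \<in> set C" using add z(1) by blast
      then obtain j where "j < length C" "C ! j = z" by (metis in_set_conv_nth)
      then show False using low[of j] high[of j] lh[of j] by auto
    qed
    then show ?thesis using rank_less[OF ab] ab(3) by simp
  qed
  ultimately show ?thesis
    unfolding saturated_chain_def successively_conv_nth using ne CP(1) by blast
qed

lemma maximal_chain_iff:
  "x \<in> P \<Longrightarrow> y \<in> P \<Longrightarrow> le x y \<Longrightarrow> maximal_chain P le x y C \<longleftrightarrow> saturated_chain P le \<rho> x y C"
  using maximal_imp_saturated_chain saturated_imp_maximal_chain by blast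

end

section \<open>Label sequences and the lexicographic order\<close>

lemma label_seq_simps [simp]:
  "label_seq lab [c] = []"
  "label_seq lab (c # d # C) = lab c d # label_seq lab (d # C)"
  by (simp_all add: label_seq_def)

lemma label_seq_snoc: "C \<noteq> [] \<Longrightarrow> label_seq lab (C @ [z]) = label_seq lab C @ [lab (last C) z]"
proof (induction C rule: induct_list012)
  case (3 c d C)
  then show ?case by simp
qed simp_all

lemma lex_less_Cons: "lex_less s t \<Longrightarrow> lex_less (p # s) (p # t)"
  unfolding lex_less_def by (metis Suc_less_eq length_Cons nth_Cons_Suc take_Suc_Cons)

lemma lex_less_hd: "p < q \<Longrightarrow> lex_less (p # s) (q # t)"
  unfolding lex_less_def by (rule exI[of _ 0]) simp

text \<open>Among all ways of pairing off two finite sets in sequence, pairing them in increasing order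
  comes first, since its next entry is always the least of what remains in both coordinates.\<close>

lemma lex_less_zip_sorted:
  fixes s :: "(nat \<times> nat) list"
  assumes "distinct (map fst s)" "distinct (map snd s)"
    and "s \<noteq> zip (sorted_list_of_set (set (map fst s))) (sorted_list_of_set (set (map snd s)))"
  shows "lex_less (zip (sorted_list_of_set (set (map fst s))) (sorted_list_of_set (set (map snd s)))) s"
  using assms
proof (induction s)
  case (Cons p s)
  let ?A = "set (map fst (p # s))" and ?B = "set (map snd (p # s))"
  have sl: "sorted_list_of_set ?A = Min ?A # sorted_list_of_set (?A - {Min ?A})"
    "sorted_list_of_set ?B = Min ?B # sorted_list_of_set (?B - {Min ?B})"
    by (rule sorted_list_of_set_nonempty; simp)+
  show ?case
  proof (cases "p = (Min ?A, Min ?B)")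
    case True
    then have "fst p = Min ?A" "snd p = Min ?B" by (metis fst_conv, metis snd_conv)
    then have "?A - {Min ?A} = set (map fst s)" "?B - {Min ?B} = set (map snd s)"
      using Cons.prems(1,2) by auto
    then have z: "zip (sorted_list_of_set ?A) (sorted_list_of_set ?B) =
        p # zip (sorted_list_of_set (set (map fst s))) (sorted_list_of_set (set (map snd s)))"
      using sl True by simp
    then have "s \<noteq> zip (sorted_list_of_set (set (map fst s))) (sorted_list_of_set (set (map snd s)))"
      using Cons.prems(3) by metis
    then show ?thesis unfolding z using Cons.IH Cons.prems(1,2) by (intro lex_less_Cons) simp
  next
    case False
    have "Min ?A \<le> fst p" "Min ?B \<le> snd p" by (rule Min_le; simp)+
    then have "(Min ?A, Min ?B) < p" using False by (simp add: less_le less_eq_prod_def)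
    then show ?thesis unfolding sl zip_Cons_Cons by (rule lex_less_hd)
  qed
qed simp

text \<open>Increasing in the product order means increasing in each coordinate, and a sorted
  distinct list is determined by its set.\<close>

lemma sorted_wrt_imp_zip_sorted:
  fixes s :: "(nat \<times> nat) list"
  assumes "distinct (map fst s)" "distinct (map snd s)" "sorted_wrt (\<le>) s"
  shows "s = zip (sorted_list_of_set (set (map fst s))) (sorted_list_of_set (set (map snd s)))"
proof -
  have "sorted (map fst s)" "sorted (map snd s)"
    unfolding sorted_wrt_map using assms(3)
    by (auto elim!: sorted_wrt_mono_rel[rotated] simp: less_eq_prod_def)
  then show ?thesis
    using assms(1,2) by (simp only: sorted_list_of_set.idem_if_sorted_distinct zip_map_fst_snd)
qed

text \<open>A lattice path matroid determines its two paths, hence also the removed elements, so the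
  definite description has a unique solution.\<close>

lemma good_pair_label_eq:
  assumes UL: "lpm_pair n U L" and ab: "a \<in> U" "b \<in> L" and UL': "lpm_pair n (U - {a}) (L - {b})"
  shows "good_pair_label n (lpm n (U - {a}) (L - {b})) (lpm n U L) = (b, a)"
  unfolding good_pair_label_def
proof (rule the_equality)
  show "case (b, a) of (l, u) \<Rightarrow> \<exists>V K. lpm_pair n V K \<and> l \<in> K \<and> u \<in> V \<and>
      lpm_pair n (V - {u}) (K - {l}) \<and> lpm n U L = lpm n V K \<and>
      lpm n (U - {a}) (L - {b}) = lpm n (V - {u}) (K - {l})"
    using assms by auto
  fix p :: "nat \<times> nat"
  obtain l u where p: "p = (l, u)" by (cases p)
  assume "case p of (l, u) \<Rightarrow> \<exists>V K. lpm_pair n V K \<and> l \<in> K \<and> u \<in> V \<and>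
      lpm_pair n (V - {u}) (K - {l}) \<and> lpm n U L = lpm n V K \<and>
      lpm n (U - {a}) (L - {b}) = lpm n (V - {u}) (K - {l})"
  then obtain V K where VK: "lpm_pair n V K" "l \<in> K" "u \<in> V" "lpm_pair n (V - {u}) (K - {l})"
    "lpm n U L = lpm n V K" "lpm n (U - {a}) (L - {b}) = lpm n (V - {u}) (K - {l})"
    unfolding p by blast
  have "U = V" "L = K" using lpm_inject[OF UL VK(1,5)] by auto
  moreover have "U - {a} = V - {u}" "L - {b} = K - {l}" using lpm_inject[OF UL' VK(4,6)] by auto
  ultimately show "p = (b, a)" using VK(2,3) ab unfolding p by blast
qed

section \<open>The graded poset of lattice path matroids\<close>

abbreviation lpm_rank :: "nat bases_system \<Rightarrow> nat" where
  "lpm_rank M \<equiv> rk M (ground M)"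

lemma lpm_rank: "lpm_pair n U L \<Longrightarrow> lpm_rank (lpm n U L) = card U"
  using rk_lpm_ground by simp

lemma LPMsE:
  assumes "M \<in> LPMs n" obtains U L where "M = lpm n U L" "lpm_pair n U L"
  using assms unfolding LPMs_def by blast

lemma LPMsI: "lpm_pair n U L \<Longrightarrow> lpm n U L \<in> LPMs n"
  unfolding LPMs_def by blast

lemma lpm_eq_if_card_eq:
  assumes UL: "lpm_pair n U L" and UL': "lpm_pair n U' L'"
    and sub: "U' \<subseteq> U" "L' \<subseteq> L" and card: "card U' = card U"
  shows "U' = U" "L' = L"
proof -
  show "U' = U" using sub(1) card lpm_pair_simps(4)[OF UL] by (simp add: card_subset_eq)
  have "card L' = card L" using card lpm_pair_simps(3)[OF UL] lpm_pair_simps(3)[OF UL'] by simp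
  then show "L' = L" using sub(2) lpm_pair_simps(5)[OF UL] by (simp add: card_subset_eq)
qed

text \<open>Removing the largest pair stays above the smaller matroid and already exhausts the rank
  difference of one, so it arrives there.\<close>

lemma lpm_cover:
  assumes UL: "lpm_pair n U L" and UL': "lpm_pair n U' L'"
    and q: "matroid_quotient (lpm n U' L') (lpm n U L)" and card: "card U = Suc (card U')"
  obtains a b where "a \<notin> U'" "b \<notin> L'" "U = insert a U'" "L = insert b L'"
    "good_pair_label n (lpm n U' L') (lpm n U L) = (b, a)"
proof -
  have g: "all_good U' L' U L" using q lpm_quotient_iff[OF UL UL'] by simp
  have "U' \<noteq> U" using card by auto
  then obtain a b where a: "a \<in> U - U'" and b: "b \<in> L - L'"
    and UL1: "lpm_pair n (U - {a}) (L - {b})" and g1: "all_good U' L' (U - {a}) (L - {b})"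
    by (rule all_good_remove_Max[OF UL UL' g])
  have "card U' = card (U - {a})" using a card by simp
  then have eq: "U' = U - {a}" "L' = L - {b}"
    using lpm_eq_if_card_eq[OF UL1 UL'] g1 unfolding all_good_def by auto
  have "good_pair_label n (lpm n U' L') (lpm n U L) = (b, a)"
    unfolding eq using good_pair_label_eq[OF UL _ _ UL1] a b by simp
  then show ?thesis using a b eq by (intro that[of a b]) auto
qed

text \<open>Transitivity passes through the rank inequality, and the intermediate element is
  obtained by removing the largest pair from the top.\<close>

interpretation lpm_poset: graded_poset "LPMs n" matroid_quotient lpm_rank for n
proof
  fix x y z assume x: "x \<in> LPMs n"
  obtain U' L' where x': "x = lpm n U' L'" "lpm_pair n U' L'" using x by (rule LPMsE)
  show "matroid_quotient x x"
    unfolding x'(1) lpm_quotient_iff[OF x'(2) x'(2)] by (simp add: all_good_def)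
  assume y: "y \<in> LPMs n"
  obtain U L where y': "y = lpm n U L" "lpm_pair n U L" using y by (rule LPMsE)
  {
    assume z: "z \<in> LPMs n" and q: "matroid_quotient x y" "matroid_quotient y z"
    have "matroid x" "matroid z" using x z matroid_lpm by (auto simp: LPMs_def)
    moreover have "rank_quotient x z"
      by (rule rank_quotient_trans[OF q[THEN matroid_quotient_imp_rank_quotient]])
    ultimately show "matroid_quotient x z"
      using rank_quotient_imp_matroid_quotient infinite_UNIV_nat by blast
  next
    assume q: "matroid_quotient x y"
    then have g: "all_good U' L' U L" using lpm_quotient_iff x' y' by simp
    have sub: "U' \<subseteq> U" "L' \<subseteq> L" using g by (auto simp: all_good_def)
    {
      assume "x \<noteq> y"
      then have "card U' \<noteq> card U" using lpm_eq_if_card_eq[OF y'(2) x'(2) sub] x' y' by auto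
      then show "lpm_rank x < lpm_rank y"
        using card_mono[OF lpm_pair_simps(4)[OF y'(2)] sub(1)] lpm_rank x' y' by simp
    next
      assume "Suc (lpm_rank x) < lpm_rank y"
      then have lt: "Suc (card U') < card U" using lpm_rank x' y' by simp
      then have "U' \<noteq> U" by auto
      then obtain a b where a: "a \<in> U - U'" and gp: "good_pair U L b a"
        and UL1: "lpm_pair n (U - {a}) (L - {b})" and g1: "all_good U' L' (U - {a}) (L - {b})"
        by (rule all_good_remove_Max[OF y'(2) x'(2) g])
      let ?z = "lpm n (U - {a}) (L - {b})"
      have "matroid_quotient x ?z" using lpm_quotient_iff[OF UL1 x'(2)] g1 x'(1) by simp
      moreover have "matroid_quotient ?z y"
        unfolding y'(1) by (intro rank_quotient_imp_matroid_quotient infinite_UNIV_nat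
            good_pair_rank_quotient[OF y'(2) gp] matroid_lpm[OF y'(2)] matroid_lpm[OF UL1])
      moreover have "lpm_rank ?z = card U - 1" using lpm_rank[OF UL1] a by simp
      moreover have "lpm_rank x = card U'" "lpm_rank y = card U" using lpm_rank x' y' by simp_all
      ultimately show "\<exists>z\<in>LPMs n. matroid_quotient x z \<and> matroid_quotient z y \<and>
          lpm_rank x < lpm_rank z \<and> lpm_rank z < lpm_rank y"
        using lt by (intro bexI[of _ ?z] LPMsI[OF UL1]) simp
    }
  }
qed

abbreviation lpm_chain where
  "lpm_chain n \<equiv> saturated_chain (LPMs n) matroid_quotient lpm_rank"

text \<open>Read upwards, each cover inserts a new element into both paths, so no coordinate is ever
  repeated.\<close>

lemma lpm_chain_labels:
  assumes "lpm_chain n (lpm n U' L') (lpm n U L) C" "lpm_pair n U L" "lpm_pair n U' L'"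
  defines "s \<equiv> label_seq (good_pair_label n) C"
  shows "distinct (map fst s) \<and> distinct (map snd s) \<and> U' \<subseteq> U \<and> L' \<subseteq> L \<and>
    set (map fst s) = L - L' \<and> set (map snd s) = U - U'"
  unfolding s_def using assms(1,3)
proof (induction C arbitrary: U' L' rule: induct_list012)
  case 1
  then show ?case by (simp add: saturated_chain_Nil)
next
  case (2 c)
  then have "lpm n U' L' = lpm n U L" by (auto simp: saturated_chain_simps)
  then show ?case using lpm_inject[OF "2.prems"(2) assms(2)] by simp
next
  case (3 c d C)
  have c: "c = lpm n U' L'" and q: "matroid_quotient (lpm n U' L') d"
    and rank: "lpm_rank d = Suc (lpm_rank (lpm n U' L'))"
    and sat: "lpm_chain n d (lpm n U L) (d # C)"
    using "3.prems"(1) by (auto simp: saturated_chain_simps)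
  have "d \<in> LPMs n" using sat by (simp add: saturated_chain_def)
  then obtain V K where d: "d = lpm n V K" and VK: "lpm_pair n V K" by (rule LPMsE)
  have "card V = Suc (card U')"
    using rank lpm_rank[OF VK] lpm_rank[OF "3.prems"(2)] by (simp add: d)
  then obtain a b where ab: "a \<notin> U'" "b \<notin> L'" "V = insert a U'" "K = insert b L'"
    "good_pair_label n (lpm n U' L') (lpm n V K) = (b, a)"
    by (rule lpm_cover[OF VK "3.prems"(2) q[unfolded d]])
  have sat': "lpm_chain n (lpm n V K) (lpm n U L) (d # C)" using sat by (simp add: d)
  note IH = "3.IH"(2)[OF sat' VK]
  show ?case using IH ab unfolding c d by auto
qed

text \<open>A label names the two elements to insert, so the bottom and the labels determine the
  chain step by step.\<close>

lemma lpm_chain_eq_if_labels_eq: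
  assumes "lpm_chain n x y C" "lpm_chain n x y D"
    "label_seq (good_pair_label n) C = label_seq (good_pair_label n) D"
  shows "C = D"
  using assms
proof (induction C arbitrary: x D rule: induct_list012)
  case 1
  then show ?case by (simp add: saturated_chain_Nil)
next
  case (2 c)
  then show ?case
    by (cases D rule: remdups_adj.cases) (auto simp: saturated_chain_simps saturated_chain_Nil)
next
  case (3 c d C)
  obtain e D' where D: "D = c # e # D'"
    using "3.prems" by (cases D rule: remdups_adj.cases) (auto simp: saturated_chain_simps saturated_chain_Nil)
  have x: "x = c" "x \<in> LPMs n" using "3.prems"(1) by (auto simp: saturated_chain_simps)
  obtain U' L' where c: "c = lpm n U' L'" and UL': "lpm_pair n U' L'" using x by (metis LPMsE)
  have next_of: "\<exists>a b. a \<notin> U' \<and> b \<notin> L' \<and> f = lpm n (insert a U') (insert b L') \<and>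
      good_pair_label n c f = (b, a)" if sat: "lpm_chain n x y (c # f # F)" for f F
  proof -
    have f: "f \<in> LPMs n" "matroid_quotient c f" "lpm_rank f = Suc (lpm_rank c)"
      using sat by (auto simp: saturated_chain_def)
    obtain V K where VK: "f = lpm n V K" "lpm_pair n V K" using f(1) by (rule LPMsE)
    have "card V = Suc (card U')" using f(3) lpm_rank[OF VK(2)] lpm_rank[OF UL'] VK(1) c by simp
    then show ?thesis
      using lpm_cover[OF VK(2) UL'] f(2) VK(1) c by metis
  qed
  have "d = e" using next_of[OF "3.prems"(1)] next_of[OF "3.prems"(2)[unfolded D]] "3.prems"(3)
    unfolding D by auto
  moreover have "d # C = e # D'"
    using "3.prems" "3.IH"(2)[of d "e # D'"] \<open>d = e\<close> unfolding D
    by (auto simp: saturated_chain_simps)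
  ultimately show ?case unfolding D by simp
qed

text \<open>The chain is built from the top: the largest pair labels the last cover, and all labels
  below it come from the smaller remaining elements.\<close>

lemma lpm_increasing_chain:
  assumes "lpm_pair n U L" "lpm_pair n U' L'" "all_good U' L' U L"
  shows "\<exists>C. lpm_chain n (lpm n U' L') (lpm n U L) C \<and>
    sorted_wrt (\<le>) (label_seq (good_pair_label n) C)"
  using assms(1,3)
proof (induction "card (U - U')" arbitrary: U L rule: less_induct)
  case less
  note UL = less.prems(1) and g = less.prems(2)
  show ?case
  proof (cases "U' = U")
    case True
    then have "L' = L" using lpm_eq_if_card_eq(2)[OF UL assms(2)] g by (auto simp: all_good_def)
    then show ?thesis using True LPMsI[OF UL]
      by (intro exI[of _ "[lpm n U L]"]) (simp add: saturated_chain_simps)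
  next
    case False
    obtain a b where a: "a \<in> U - U'" and b: "b \<in> L - L'" and gp: "good_pair U L b a"
      and UL1: "lpm_pair n (U - {a}) (L - {b})" and g1: "all_good U' L' (U - {a}) (L - {b})"
      and max: "\<And>x. x \<in> U - {a} - U' \<Longrightarrow> x \<le> a" "\<And>x. x \<in> L - {b} - L' \<Longrightarrow> x \<le> b"
      by (rule all_good_remove_Max[OF UL assms(2) g False]) blast
    let ?z = "lpm n (U - {a}) (L - {b})" and ?y = "lpm n U L"
    have "U - {a} - U' \<subset> U - U'" using a by blast
    then have "card (U - {a} - U') < card (U - U')"
      using lpm_pair_simps(4)[OF UL] by (intro psubset_card_mono) auto
    then obtain C where C: "lpm_chain n (lpm n U' L') ?z C"
      "sorted_wrt (\<le>) (label_seq (good_pair_label n) C)"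
      using less.hyps UL1 g1 by blast
    have "C \<noteq> []" "last C = ?z" using C(1) by (simp_all add: saturated_chain_def)
    then have lab: "label_seq (good_pair_label n) (C @ [?y]) = label_seq (good_pair_label n) C @ [(b, a)]"
      using good_pair_label_eq[OF UL _ _ UL1] a b by (simp add: label_seq_snoc)
    have "p \<le> (b, a)" if p: "p \<in> set (label_seq (good_pair_label n) C)" for p
    proof -
      have "fst p \<in> L - {b} - L'" "snd p \<in> U - {a} - U'"
        using lpm_chain_labels[OF C(1) UL1 assms(2)] p by auto
      then show ?thesis using max by (simp add: less_eq_prod_def)
    qed
    then have "sorted_wrt (\<le>) (label_seq (good_pair_label n) (C @ [?y]))"
      unfolding lab using C(2) by (simp add: sorted_wrt_append)
    moreover have "lpm_chain n (lpm n U' L') ?y (C @ [?y])"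
    proof (rule saturated_chain_snoc[OF C(1) LPMsI[OF UL]])
      show "matroid_quotient ?z ?y"
        by (intro rank_quotient_imp_matroid_quotient infinite_UNIV_nat
            good_pair_rank_quotient[OF UL gp] matroid_lpm[OF UL] matroid_lpm[OF UL1])
      show "lpm_rank ?y = Suc (lpm_rank ?z)"
        unfolding lpm_rank[OF UL] lpm_rank[OF UL1]
        using a lpm_pair_simps(4)[OF UL] by (intro card_Suc_Diff1[symmetric]) auto
    qed
    ultimately show ?thesis by blast
  qed
qed

theorem theorem3p1:
  fixes n :: nat
  assumes "n \<ge> 1"
  shows "EL_labeling (LPMs n) matroid_quotient ({1..n} \<times> {1..n}) (good_pair_label n)"
  unfolding EL_labeling_def
proof (intro conjI allI impI ballI)
  fix x y assume "covers (LPMs n) matroid_quotient x y"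
  then have xy: "x \<in> LPMs n" "y \<in> LPMs n" "matroid_quotient x y" "lpm_rank y = Suc (lpm_rank x)"
    using lpm_poset.covers_rank by auto
  obtain U' L' where x: "x = lpm n U' L'" "lpm_pair n U' L'" using xy(1) by (rule LPMsE)
  obtain U L where y: "y = lpm n U L" "lpm_pair n U L" using xy(2) by (rule LPMsE)
  have "card U = Suc (card U')" using xy(4) lpm_rank x y by simp
  then obtain a b where "U = insert a U'" "L = insert b L'" "good_pair_label n x y = (b, a)"
    using lpm_cover[OF y(2) x(2)] xy(3) x(1) y(1) by metis
  then show "good_pair_label n x y \<in> {1..n} \<times> {1..n}"
    using lpm_pair_simps(1,2)[OF y(2)] by auto
next
  let ?lab = "label_seq (good_pair_label n)"
  fix x y assume xy: "x \<in> LPMs n" "y \<in> LPMs n" "matroid_quotient x y"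
  obtain U' L' where x: "x = lpm n U' L'" and UL': "lpm_pair n U' L'" using xy(1) by (rule LPMsE)
  obtain U L where y: "y = lpm n U L" and UL: "lpm_pair n U L" using xy(2) by (rule LPMsE)
  note max = lpm_poset.maximal_chain_iff[OF xy]
  \<comment> \<open>All label sequences of the interval list the same two sets, so \<open>s0\<close>
    is the only one that can be increasing. Uniqueness and lexicographic minimality both become
    comparisons with it.\<close>
  define s0 where "s0 = zip (sorted_list_of_set (L - L')) (sorted_list_of_set (U - U'))"
  have labels: "distinct (map fst (?lab C))" "distinct (map snd (?lab C))"
    "set (map fst (?lab C)) = L - L'" "set (map snd (?lab C)) = U - U'" if "lpm_chain n x y C" for C
    using lpm_chain_labels[OF that[unfolded x y] UL UL'] by blast+
  have inc: "?lab C = s0" if "lpm_chain n x y C" "sorted_wrt (\<le>) (?lab C)" for C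
    using sorted_wrt_imp_zip_sorted[OF labels(1,2)[OF that(1)] that(2)]
    unfolding labels(3,4)[OF that(1)] s0_def .
  have lex: "lex_less s0 (?lab C)" if "lpm_chain n x y C" "?lab C \<noteq> s0" for C
    using lex_less_zip_sorted[OF labels(1,2)[OF that(1)]] that(2)
    unfolding labels(3,4)[OF that(1)] s0_def by blast
  have "all_good U' L' U L" using lpm_quotient_iff[OF UL UL'] xy(3) x y by simp
  then obtain C where C: "lpm_chain n x y C" "sorted_wrt (\<le>) (?lab C)"
    using lpm_increasing_chain[OF UL UL'] x y by blast
  have C0: "?lab C = s0" using inc C by simp
  have uniq: "D = C" if "lpm_chain n x y D" "?lab D = s0" for D
    using lpm_chain_eq_if_labels_eq[OF that(1) C(1)] that(2) C0 by simp
  show "\<exists>C. maximal_chain (LPMs n) matroid_quotient x y C \<and> sorted_wrt (\<le>) (?lab C) \<and>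
      (\<forall>C'. maximal_chain (LPMs n) matroid_quotient x y C' \<and> sorted_wrt (\<le>) (?lab C') \<longrightarrow> C' = C) \<and>
      (\<forall>C'. maximal_chain (LPMs n) matroid_quotient x y C' \<and> C' \<noteq> C \<longrightarrow>
        lex_less (?lab C) (?lab C'))"
    unfolding max
  proof (intro exI[of _ C] conjI allI impI; (elim conjE)?)
    show "lpm_chain n x y C" "sorted_wrt (\<le>) (?lab C)" using C .
    show "D = C" if "lpm_chain n x y D" "sorted_wrt (\<le>) (?lab D)" for D
      using uniq[OF that(1) inc[OF that]] .
    show "lex_less (?lab C) (?lab D)" if "lpm_chain n x y D" "D \<noteq> C" for D
      unfolding C0 using lex[OF that(1)] uniq[OF that(1)] that(2) by blast
  qed
qed

end
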